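(* Let $\mathbf{A}\in\mathbb{R}^{m\times n}$, $\mathbf{b}\in\mathbb{R}^m$, $\mathbf{c}\in\mathbb{R}^n$ and $\eta\in(0,1/\|\mathbf{A}\|_2)$. Consider one phase of PDHG (as defined in the context) with PDHG basis $(B,N)$, and index its iterates as $(\mathbf{x}^{(k)},\mathbf{y}^{(k)})$, $k=0,1,2,\dots$, where $\mathbf{z}^{(0)}=(\mathbf{x}^{(0)},\mathbf{y}^{(0)})$ is the initial point of the phase. Define $$\mathbf{P}_B=\begin{bmatrix}\mathbf{I}_{|B|} & \eta\mathbf{A}_B^\top\\ -\eta\mathbf{A}_B & \mathbf{I}_m-2\eta^2\mathbf{A}_B\mathbf{A}_B^\top\end{bmatrix},$$ the spiral center $\mathbf{z}_{\mathbf{v}}=(\mathbf{x}_{\mathbf{v}},\mathbf{y}_{\mathbf{v}})$ by $$(\mathbf{x}_{\mathbf{v}})_B=(\mathbf{A}_B^\top\mathbf{A}_B)^\dagger\mathbf{A}_B^\top\mathbf{b}+\mathrm{Proj}_{\{\mathbf{x}:\mathbf{A}_B\mathbf{x}=\mathbf{0}\}}(\mathbf{x}_B^{(0)}),\quad(\mathbf{x}_{\mathbf{v}})_N=\mathbf{0},$$ $$\mathbf{y}_{\mathbf{v}}=(\mathbf{A}_B\mathbf{A}_B^\top)^\dagger\mathbf{A}_B\mathbf{c}_B+\mathrm{Proj}_{\{\mathbf{y}:\mathbf{A}_B^\top\mathbf{y}=\mathbf{0}\}}(\mathbf{y}^{(0)}),$$ and the ray direction $\mathbf{v}=(\mathbf{v}_{\mathbf{x}},\mathbf{v}_{\mathbf{y}})$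 by $$(\mathbf{v}_{\mathbf{x}})_B=-\eta\left[\mathbf{c}_B-\mathbf{A}_B^\top(\mathbf{A}_B\mathbf{A}_B^\top)^\dagger\mathbf{A}_B\mathbf{c}_B\right],\quad(\mathbf{v}_{\mathbf{x}})_N=\mathbf{0},$$ $$\mathbf{v}_{\mathbf{y}}=\eta\left[\mathbf{b}-\mathbf{A}_B(\mathbf{A}_B^\top\mathbf{A}_B)^\dagger\mathbf{A}_B^\top\mathbf{b}\right].$$ Then within the phase PDHG iterates as $$\begin{bmatrix}\mathbf{x}_B^{(k)}-(\mathbf{x}_{\mathbf{v}})_B\\ \mathbf{y}^{(k)}-\mathbf{y}_{\mathbf{v}}\end{bmatrix}=\mathbf{P}_B^k\begin{bmatrix}\mathbf{x}_B^{(0)}-(\mathbf{x}_{\mathbf{v}})_B\\ \mathbf{y}^{(0)}-\mathbf{y}_{\mathbf{v}}\end{bmatrix}+k\begin{bmatrix}(\mathbf{v}_{\mathbf{x}})_B\\ \mathbf{v}_{\mathbf{y}}\end{bmatrix},\qquad\mathbf{x}_N^{(k)}=\mathbf{0}.$$ Moreover, the rotation part converges to zero, i.e. $$\lim_{k\to\infty}\mathbf{P}_B^k\begin{bmatrix}\mathbf{x}_B^{(0)}-(\mathbf{x}_{\mathbf{v}})_B\\ \mathbf{y}^{(0)}-\mathbf{y}_{\mathbf{v}}\end{bmatrix}=\mathbf{0},$$ and the forward movement is orthogonal to the rotation, i.e., with $\mathbf{v}_B=((\mathbf{v}_{\mathbf{x}})_B,\mathbf{v}_{\mathbf{y}})$,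 $$\mathbf{v}_B^\top\mathbf{P}_B^k\begin{bmatrix}\mathbf{x}_B^{(0)}-(\mathbf{x}_{\mathbf{v}})_B\\ \mathbf{y}^{(0)}-\mathbf{y}_{\mathbf{v}}\end{bmatrix}=0\quad\text{for all }k.$$
   Context: The LP is $\min\{\mathbf{c}^\top\mathbf{x}:\mathbf{A}\mathbf{x}=\mathbf{b},\ \mathbf{x}\ge\mathbf{0}\}$. PDHG (primal-dual hybrid gradient) with step size $\eta$ starts from a point in $\mathbb{R}^n_+\times\mathbb{R}^m$ and iterates $$\mathbf{x}^{(k+1)}=\mathrm{Proj}_{\mathbb{R}^n_+}\big(\mathbf{x}^{(k)}-\eta(\mathbf{c}-\mathbf{A}^\top\mathbf{y}^{(k)})\big),\qquad\mathbf{y}^{(k+1)}=\mathbf{y}^{(k)}+\eta\big(\mathbf{b}-\mathbf{A}(2\mathbf{x}^{(k+1)}-\mathbf{x}^{(k)})\big).$$ Notation: $\mathbf{A}_i$ is the $i$-th column of $\mathbf{A}$; for an index set $J$, $\mathbf{A}_J$ is the submatrix of columns indexed by $J$ and $\mathbf{x}_J$ the corresponding subvector; $\mathbf{I}_d$ is the $d\times d$ identity matrix; $\|\cdot\|_2$ of a matrix is the spectral norm; $^\dagger$ is the Moore–Penrose inverse; $\mathrm{Proj}_S$ is Euclidean projection onto $S$; $\mathbf{P}_B^k$ is the $k$-th power of $\mathbf{P}_B$. PDHG basis: for an iterate $(\mathbf{x},\mathbf{y})$, the basis $B$ and non-basis $N$ form the partition of the primal variables given by $B=\{i:\mathbf{x}_i>0\}\cup\{i:\mathbf{x}_i=0,\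 \mathbf{c}_i-\mathbf{A}_i^\top\mathbf{y}\le 0\}$ and $N=\{i:\mathbf{x}_i=0,\ \mathbf{c}_i-\mathbf{A}_i^\top\mathbf{y}>0\}$. Phase: a sequence of consecutive PDHG iterations forms a phase if they share the same PDHG basis $(B,N)$.
   Formalization: The closed formula for iterate k is claimed only if in every earlier step of the phase x−η(c−A^T y) is nonnegative on B (projection inactive on B); otherwise it fails, e.g. A=1, b=10, c=1, η=1/2, x0=1/10, y0=0. *)

theory Defs
  imports
    "HOL-Library.Extended_Nat"
    "Jordan_Normal_Form.Matrix_Kernel"
    "Jordan_Normal_Form.DL_Submatrix"
begin

definition vnorm :: "real vec \<Rightarrow> real" where
  "vnorm v = sqrt (v \<bullet> v)"

definition spectral_norm :: "real mat \<Rightarrow> real" where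
  "spectral_norm A = Sup {vnorm (A *\<^sub>v x) | x. x \<in> carrier_vec (dim_col A) \<and> vnorm x \<le> 1}"

text \<open>The type \<open>real vec\<close> carries no topology, so convergence of a sequence of vectors
  (all of the same dimension as the limit) is spelled out in the Euclidean norm.\<close>

definition vec_tendsto :: "(nat \<Rightarrow> real vec) \<Rightarrow> real vec \<Rightarrow> bool" where
  "vec_tendsto X l \<longleftrightarrow> (\<forall>k. dim_vec (X k) = dim_vec l) \<and> (\<lambda>k. vnorm (X k - l)) \<longlonglongrightarrow> 0"

text \<open>Euclidean projection: the unique nearest point of \<open>S\<close>, where \<open>S\<close> is a nonempty closed convex
  set of vectors of the same dimension as \<open>x\<close>.\<close>

definition euclid_proj :: "real vec set \<Rightarrow> real vec \<Rightarrow> real vec" where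
  "euclid_proj S x = (THE p. p \<in> S \<and> (\<forall>q\<in>S. vnorm (x - p) \<le> vnorm (x - q)))"

text \<open>Moore--Penrose inverse, by the four Penrose equations.\<close>

definition pinv :: "real mat \<Rightarrow> real mat" where
  "pinv M = (THE X. X \<in> carrier_mat (dim_col M) (dim_row M) \<and>
     M * X * M = M \<and> X * M * X = X \<and>
     transpose_mat (M * X) = M * X \<and> transpose_mat (X * M) = X * M)"

text \<open>Index sets are sets of zero-based indices; \<open>pick J\<close> enumerates \<open>J\<close> in increasing order, so
  that \<open>subvec\<close> and \<open>subcols\<close> list their entries and columns in the same order.\<close>

definition subvec :: "real vec \<Rightarrow> nat set \<Rightarrow> real vec" where
  "subvec x J = vec (card {i. i < dim_vec x \<and> i \<in> J}) (\<lambda>i. x $ pick J i)"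

definition subcols :: "real mat \<Rightarrow> nat set \<Rightarrow> real mat" where
  "subcols A J = submatrix A UNIV J"

definition nonneg_orthant :: "nat \<Rightarrow> real vec set" where
  "nonneg_orthant n = {x \<in> carrier_vec n. \<forall>i<n. 0 \<le> x $ i}"

text \<open>The argument of the projection in the primal update.\<close>

definition primal_gradient_step ::
  "real mat \<Rightarrow> real vec \<Rightarrow> real \<Rightarrow> real vec \<times> real vec \<Rightarrow> real vec" where
  "primal_gradient_step A c \<eta> = (\<lambda>(x, y). x - \<eta> \<cdot>\<^sub>v (c - transpose_mat A *\<^sub>v y))"

definition pdhg_step ::
  "real mat \<Rightarrow> real vec \<Rightarrow> real vec \<Rightarrow> real \<Rightarrow> real vec \<times> real vec \<Rightarrow> real vec \<times> real vec" where
  "pdhg_step A b c \<eta> = (\<lambda>(x, y).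
     let x' = euclid_proj (nonneg_orthant (dim_col A)) (primal_gradient_step A c \<eta> (x, y))
     in (x', y + \<eta> \<cdot>\<^sub>v (b - A *\<^sub>v (2 \<cdot>\<^sub>v x' - x))))"

definition pdhg ::
  "real mat \<Rightarrow> real vec \<Rightarrow> real vec \<Rightarrow> real \<Rightarrow> real vec \<times> real vec \<Rightarrow> nat \<Rightarrow> real vec \<times> real vec" where
  "pdhg A b c \<eta> z k = (pdhg_step A b c \<eta> ^^ k) z"

definition pdhg_basis ::
  "real mat \<Rightarrow> real vec \<Rightarrow> real vec \<times> real vec \<Rightarrow> nat set \<times> nat set" where
  "pdhg_basis A c = (\<lambda>(x, y).
     ({i. i < dim_col A \<and> x $ i > 0} \<union>
      {i. i < dim_col A \<and> x $ i = 0 \<and> c $ i - col A i \<bullet> y \<le> 0},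
      {i. i < dim_col A \<and> x $ i = 0 \<and> c $ i - col A i \<bullet> y > 0}))"

text \<open>The iterates number \<open>s, s + 1, \<dots>\<close> (\<open>L\<close> of them, possibly infinitely many) of the run started
  at \<open>z\<close> form a phase.\<close>

definition pdhg_phase ::
  "real mat \<Rightarrow> real vec \<Rightarrow> real vec \<Rightarrow> real \<Rightarrow> real vec \<times> real vec \<Rightarrow> nat \<Rightarrow> enat \<Rightarrow>
   nat set \<Rightarrow> nat set \<Rightarrow> bool" where
  "pdhg_phase A b c \<eta> z s L B N \<longleftrightarrow>
     0 < L \<and> (\<forall>k. enat k < L \<longrightarrow> pdhg_basis A c (pdhg A b c \<eta> z (s + k)) = (B, N))"

text \<open>The projection does not change any coordinate in \<open>B\<close> when stepping from \<open>z\<close>. Sharing the basis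
  does not imply this: for \<open>A = [1]\<close>, \<open>b = 10\<close>, \<open>c = 1\<close>, \<open>\<eta> = 1/2\<close>, the step from \<open>(1/10, 0)\<close> clips
  \<open>-2/5\<close> to \<open>0\<close> and leads to \<open>(0, 101/20)\<close>, which has the same basis since its reduced cost is
  negative, although the new \<open>x\<close> is \<open>0\<close> and not the unprojected \<open>-2/5\<close>.\<close>

definition unclipped_on ::
  "real mat \<Rightarrow> real vec \<Rightarrow> real \<Rightarrow> nat set \<Rightarrow> real vec \<times> real vec \<Rightarrow> bool" where
  "unclipped_on A c \<eta> B z \<longleftrightarrow> (\<forall>i\<in>B. 0 \<le> primal_gradient_step A c \<eta> z $ i)"

definition P_mat :: "real mat \<Rightarrow> real \<Rightarrow> real mat" where
  "P_mat AB \<eta> = four_block_mat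
     (1\<^sub>m (dim_col AB))        (\<eta> \<cdot>\<^sub>m transpose_mat AB)
     ((- \<eta>) \<cdot>\<^sub>m AB)            (1\<^sub>m (dim_row AB) - (2 * \<eta>\<^sup>2) \<cdot>\<^sub>m (AB * transpose_mat AB))"

end

theory Submission
  imports Defs "Jordan_Normal_Form.Gauss_Jordan_Elimination"
begin

text \<open>As long as the projection is inactive on \<open>B\<close>, a PDHG step is an affine map with linear part
  \<open>P\<^sub>B\<close>. The residuals \<open>c\<^sub>B - A\<^sub>B\<^sup>T y\<^sub>v\<close> and \<open>b - A\<^sub>B x\<^sub>v\<close> of the two least squares problems lie in the
  kernels of \<open>A\<^sub>B\<close> and \<open>A\<^sub>B\<^sup>T\<close>, so the ray direction is fixed by \<open>P\<^sub>B\<close> and one step moves the spiral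
  center by exactly this direction. The kernel projections in the center are chosen so that the
  initial deviation lies in \<open>range A\<^sub>B\<^sup>T \<times> range A\<^sub>B\<close>. This space is invariant under \<open>P\<^sub>B\<close> and orthogonal
  to the ray. A quadratic energy, positive definite because \<open>\<eta> \<parallel>A\<parallel> < 1\<close>, decreases along \<open>P\<^sub>B\<close> by
  the multiple \<open>\<eta>\<^sup>2\<close> of its own value at \<open>(A\<^sub>B\<^sup>T y, A\<^sub>B x)\<close>. The decrements tend to zero and, on the range
  space, they bound the squared norm of the deviation.\<close>

section \<open>Moore--Penrose inverses\<close>

text \<open>Row reduction writes \<open>A = Q * C\<close> with \<open>C = P * A\<close> in row
  echelon form. A generalised inverse \<open>H\<close> of \<open>C\<close> can be read off from the
  pivots, and \<open>H * P\<close> then serves for \<open>A\<close>.\<close>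

lemma ginverse_exists:
  fixes A :: "'a :: field mat"
  assumes A: "A \<in> carrier_mat m n"
  obtains G where "G \<in> carrier_mat n m" "A * G * A = A"
proof -
  define C where "C = gauss_jordan_single A"
  note gj = gauss_jordan_single[OF A C_def[symmetric]]
  have C: "C \<in> carrier_mat m n" and re: "row_echelon_form C" using gj(2,3) by auto
  obtain P Q where PQ: "C = P * A" "P \<in> carrier_mat m m" "Q \<in> carrier_mat m m" "Q * P = 1\<^sub>m m"
    using gj(4) by blast
  have AQC: "A = Q * C"
    using PQ A assoc_mult_mat[OF PQ(3,2) A] by simp
  obtain f where f: "pivot_fun C f n" using re C unfolding row_echelon_form_def by auto
  note p = pivot_funD[OF _ f, of m]
  \<comment> \<open>\<open>H\<close> sends the \<open>i\<close>-th unit vector to the unit vector of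
    the \<open>i\<close>-th pivot column. A zero row has \<open>f i = n\<close>, which matches no
    \<open>j < n\<close> and gives a zero column, so \<open>C * H\<close> is the diagonal projector
    onto the nonzero rows of \<open>C\<close>.\<close>
  define H where "H = mat n m (\<lambda>(j, i). if f i = j then 1 else (0 :: 'a))"
  have H: "H \<in> carrier_mat n m" unfolding H_def by simp
  have CH: "(C * H) $$ (i, k) = (if i = k \<and> f k < n then 1 else 0)" if "i < m" "k < m" for i k
  proof -
    have "(C * H) $$ (i, k) = (\<Sum>j<n. C $$ (i, j) * (if f k = j then 1 else 0))"
      using that C H by (simp add: scalar_prod_def H_def atLeast0LessThan)
    also have "\<dots> = (\<Sum>j<n. if j = f k then C $$ (i, j) else 0)"
      by (intro sum.cong) auto
    also have "\<dots> = (if f k < n then C $$ (i, f k) else 0)"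
      by simp
    also have "\<dots> = (if i = k \<and> f k < n then 1 else 0)"
      using p(4,5) that C by auto
    finally show ?thesis .
  qed
  have CHC: "C * H * C = C"
  proof (rule eq_matI)
    fix i j assume "i < dim_row C" "j < dim_col C"
    then have ij: "i < m" "j < n" using C by auto
    have "(C * H * C) $$ (i, j) = (\<Sum>k<m. (C * H) $$ (i, k) * C $$ (k, j))"
    proof -
      have "(X * C) $$ (i, j) = (\<Sum>k<m. X $$ (i, k) * C $$ (k, j))" if "X \<in> carrier_mat m m" for X
        using ij C that by (simp add: scalar_prod_def atLeast0LessThan)
      from this[of "C * H"] show ?thesis using C H by simp
    qed
    also have "\<dots> = (\<Sum>k<m. if k = i then (if f i < n then C $$ (i, j) else 0) else 0)"
      using ij CH by (intro sum.cong) auto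
    also have "\<dots> = (if f i < n then C $$ (i, j) else 0)" using ij by simp
    also have "\<dots> = C $$ (i, j)"
      using p(1)[of i] p(2)[of i j] ij C by auto
    finally show "(C * H * C) $$ (i, j) = C $$ (i, j)" .
  qed (use C H in auto)
  have HPA: "H * P * A = H * C" unfolding PQ(1) by (rule assoc_mult_mat[OF H PQ(2) A])
  have "A * (H * P) * A = Q * C * (H * C)"
    unfolding HPA[symmetric] AQC[symmetric] using A H PQ(2) by (intro assoc_mult_mat) auto
  also have "\<dots> = Q * (C * (H * C))"
    using PQ(3) C H by (intro assoc_mult_mat) auto
  also have "C * (H * C) = C * H * C" by (rule assoc_mult_mat[OF C H C, symmetric])
  finally have "A * (H * P) * A = Q * (C * H * C)" .
  then have "A * (H * P) * A = A" using CHC AQC by simp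
  then show thesis using that[of "H * P"] H PQ by auto
qed

section \<open>Cancelling the transposed factor of a Gram matrix\<close>

lemma scalar_prod_self_nonneg: "0 \<le> (v :: real vec) \<bullet> v"
  by (auto simp: scalar_prod_def intro: sum_nonneg)

lemma scalar_prod_self_eq_0:
  assumes "v \<in> carrier_vec n" "(v :: real vec) \<bullet> v = 0"
  shows "v = 0\<^sub>v n"
proof (rule eq_vecI)
  fix i assume i: "i < dim_vec (0\<^sub>v n :: real vec)"
  have "(\<Sum>i\<in>{0..<n}. v $ i * v $ i) = 0" using assms by (simp add: scalar_prod_def)
  then show "v $ i = 0\<^sub>v n $ i" using i by (subst (asm) sum_nonneg_eq_0_iff) auto
qed (use assms in auto)

text \<open>The diagonal entries of \<open>transpose_mat D * D\<close> are the squared norms of the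
  columns of \<open>D\<close>.\<close>

lemma transpose_mult_eq_0:
  fixes D :: "real mat"
  assumes D: "D \<in> carrier_mat m n" and "transpose_mat D * D = 0\<^sub>m n n"
  shows "D = 0\<^sub>m m n"
proof (rule eq_matI)
  fix i j assume ij: "i < dim_row (0\<^sub>m m n :: real mat)" "j < dim_col (0\<^sub>m m n :: real mat)"
  have "col D j \<bullet> col D j = (transpose_mat D * D) $$ (j, j)" using D ij by simp
  then have "col D j = 0\<^sub>v m"
    using assms D ij by (intro scalar_prod_self_eq_0) auto
  then have "col D j $ i = 0" using ij by simp
  then show "D $$ (i, j) = 0\<^sub>m m n $$ (i, j)" using D ij by simp
qed (use D in auto)

text \<open>The defect \<open>?D = A * ?E\<close> satisfies \<open>transpose_mat A * ?D = 0\<close>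
  by \<open>inv\<close>. Since \<open>?D\<close> starts with the factor \<open>A\<close>, also
  \<open>transpose_mat ?D * ?D = 0\<close>, hence \<open>?D = 0\<close>.\<close>

lemma gram_ginverse:
  fixes A G :: "real mat"
  assumes A: "A \<in> carrier_mat m n" and G: "G \<in> carrier_mat n n"
    and inv: "transpose_mat A * A * G * (transpose_mat A * A) = transpose_mat A * A"
  shows "A * G * (transpose_mat A * A) = A"
proof -
  let ?M = "transpose_mat A * A"
  let ?E = "G * ?M - 1\<^sub>m n"
  let ?D = "A * ?E"
  have M: "?M \<in> carrier_mat n n" and E: "?E \<in> carrier_mat n n" and D: "?D \<in> carrier_mat m n"
    using A G by auto
  have "transpose_mat A * ?D = ?M * ?E"
    using A E by (simp add: assoc_mult_mat[of _ n m _ n _ n])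
  also have "\<dots> = ?M * (G * ?M) - ?M * 1\<^sub>m n"
    using M G by (intro mult_minus_distrib_mat) auto
  also have "?M * (G * ?M) = ?M"
    using inv M G by (simp only: assoc_mult_mat[of ?M n n G n ?M n])
  also have "?M - ?M * 1\<^sub>m n = 0\<^sub>m n n"
    unfolding right_mult_one_mat[OF M] by (rule minus_r_inv_mat[OF M])
  finally have AD: "transpose_mat A * ?D = 0\<^sub>m n n" .
  have "transpose_mat ?D * ?D = transpose_mat ?E * (transpose_mat A * ?D)"
    using A E D by (simp add: transpose_mult[of A m n ?E n] assoc_mult_mat[of _ n n _ m _ n])
  also have "\<dots> = 0\<^sub>m n n" unfolding AD using E by (intro right_mult_zero_mat) simp
  finally have "?D = 0\<^sub>m m n" by (rule transpose_mult_eq_0[OF D])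
  moreover have "?D = A * (G * ?M) - A * 1\<^sub>m n"
    using A M G by (intro mult_minus_distrib_mat) auto
  ultimately have z: "A * G * ?M - A = 0\<^sub>m m n" using A M G by (simp add: assoc_mult_mat[of _ m n _ n _ n])
  show ?thesis
  proof (rule eq_matI)
    fix i j assume ij: "i < dim_row A" "j < dim_col A"
    have "(A * G * ?M - A) $$ (i, j) = 0" using z A ij by simp
    moreover have "(A * G * ?M - A) $$ (i, j) = (A * G * ?M) $$ (i, j) - A $$ (i, j)"
      using ij A by (intro index_minus_mat) auto
    ultimately show "(A * G * ?M) $$ (i, j) = A $$ (i, j)" by simp
  qed (use A G in auto)
qed

section \<open>The Penrose equations: uniqueness, symmetric matrices, Gram matrices\<close>

definition is_pinv :: "real mat \<Rightarrow> real mat \<Rightarrow> bool" where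
  "is_pinv M X \<longleftrightarrow> X \<in> carrier_mat (dim_col M) (dim_row M) \<and>
     M * X * M = M \<and> X * M * X = X \<and>
     transpose_mat (M * X) = M * X \<and> transpose_mat (X * M) = X * M"

text \<open>Each of the symmetric projectors \<open>M * X\<close> and \<open>M * Y\<close> absorbs
  the other. Transposing their product reverses its order, so they coincide, and likewise
  \<open>X * M = Y * M\<close>. Then \<open>X = X * M * X\<close> turns into
  \<open>Y * M * Y = Y\<close>.\<close>

lemma is_pinv_unique:
  assumes "is_pinv M X" "is_pinv M Y"
  shows "X = Y"
proof -
  obtain m n where M: "M \<in> carrier_mat m n" by (meson carrier_matI)
  then have X: "X \<in> carrier_mat n m" and Y: "Y \<in> carrier_mat n m"
    using assms by (auto simp: is_pinv_def)
  note x = assms(1)[unfolded is_pinv_def] and y = assms(2)[unfolded is_pinv_def]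
  have MX: "M * X \<in> carrier_mat m m" and MY: "M * Y \<in> carrier_mat m m"
    and XM: "X * M \<in> carrier_mat n n" and YM: "Y * M \<in> carrier_mat n n" using M X Y by auto
  have "M * X = (M * Y * M) * X" using y by simp
  also have "\<dots> = (M * Y) * (M * X)"
    using MY M X by (intro assoc_mult_mat) auto
  also have "\<dots> = transpose_mat ((M * X) * (M * Y))"
    using x y transpose_mult[OF MX MY] by simp
  also have "(M * X) * (M * Y) = M * Y"
    using x assoc_mult_mat[OF MX M Y] by simp
  finally have 1: "M * X = M * Y" using y by simp
  have "X * M = X * (M * Y * M)" using y by simp
  also have "\<dots> = X * (M * (Y * M))" using M Y assoc_mult_mat[OF M Y M] by simp
  also have "\<dots> = (X * M) * (Y * M)" using assoc_mult_mat[OF X M YM] by simp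
  also have "\<dots> = transpose_mat ((Y * M) * (X * M))"
    using x y transpose_mult[OF YM XM] by simp
  also have "(Y * M) * (X * M) = Y * M"
    using x assoc_mult_mat[OF YM X M] assoc_mult_mat[OF Y M XM] assoc_mult_mat[OF M X M] by simp
  finally have 2: "X * M = Y * M" using y by simp
  have "X = X * (M * X)" using x assoc_mult_mat[OF X M X] by simp
  also have "\<dots> = (X * M) * Y" unfolding 1 using assoc_mult_mat[OF X M Y] by simp
  also have "\<dots> = Y" unfolding 2 using y by simp
  finally show ?thesis .
qed

text \<open>For symmetric \<open>M\<close> and any generalised inverse \<open>K\<close> of \<open>M\<^sup>2\<close>, the matrix \<open>M K M K M\<close> satisfies
  the Penrose equations.\<close>

lemma is_pinv_symmetric_exists:
  assumes M: "M \<in> carrier_mat n n" and sym: "transpose_mat M = M"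
  shows "\<exists>X. is_pinv M X"
proof -
  have MM: "M * M \<in> carrier_mat n n" using M by simp
  obtain K where K: "K \<in> carrier_mat n n" and KK: "M * M * K * (M * M) = M * M"
    using ginverse_exists[OF MM] by auto
  note ass = assoc_mult_mat[of _ n n _ n _ n]
  note tr = transpose_mult[of _ n n _ n]
  \<comment> \<open>By symmetry \<open>M * M\<close> is the Gram matrix of \<open>M\<close>, so its
    leading factor can be cancelled.\<close>
  have a: "M * K * (M * M) = M" 
    using gram_ginverse[OF M K] KK sym by simp
  let ?T = "transpose_mat K"
  have T: "?T \<in> carrier_mat n n" using K by simp
  \<comment> \<open>The transpose of \<open>K\<close> is a generalised inverse of
    \<open>M * M\<close> as well. Transposing the resulting identity \<open>b\<close> gives
    \<open>c\<close>, the cancellation on the other side of \<open>K\<close>.\<close>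
  have "transpose_mat (M * M * K * (M * M)) = transpose_mat (M * M)" using KK by simp
  then have "M * M * ?T * (M * M) = M * M"
    using M K by (simp add: tr sym ass)
  then have b: "M * ?T * (M * M) = M"
    using gram_ginverse[OF M T] sym by simp
  have c: "M * M * K * M = M"
    using arg_cong[OF b, of transpose_mat] M K T by (simp add: tr sym ass)
  \<comment> \<open>\<open>F\<close> turns out to be the orthogonal projector onto the range of
    \<open>M\<close>, the common value of \<open>M * ?X\<close> and \<open>?X * M\<close>.\<close>
  define F where "F = M * K * M"
  have F: "F \<in> carrier_mat n n" using M K by (simp add: F_def)
  have FM: "F * M = M" using a M K by (simp add: F_def ass)
  have MF: "M * F = M" using c M K by (simp add: F_def ass)
  \<comment> \<open>Expanding the left \<open>M\<close> by \<open>b\<close> and contracting the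
    right end by \<open>c\<close> leaves \<open>M * ?T * M\<close>.\<close>
  have "F = M * ?T * (M * M) * K * M" unfolding F_def b by simp
  also have "\<dots> = M * ?T * (M * M * K * M)" using M K T by (simp add: ass)
  also have "\<dots> = transpose_mat F" unfolding c unfolding F_def using M K by (simp add: tr sym ass)
  finally have symF: "transpose_mat F = F" by simp
  let ?X = "F * K * M"
  have X: "?X \<in> carrier_mat n n" using M K F by simp
  have MX: "M * ?X = F"
  proof -
    have "M * ?X = M * F * K * M" using M K F by (simp add: ass)
    also have "\<dots> = F" unfolding MF by (simp add: F_def)
    finally show ?thesis .
  qed
  have XM: "?X * M = F"
  proof -
    have "?X * M = M * K * (M * K * (M * M))" using M K F by (simp add: ass F_def)
    also have "\<dots> = F" unfolding a by (simp add: F_def)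
    finally show ?thesis .
  qed
  have FX: "F * ?X = ?X"
  proof -
    have "F * ?X = (F * M) * K * M * K * M" using M K F unfolding F_def by (simp add: ass)
    also have "\<dots> = ?X" unfolding FM using M K by (simp add: F_def ass)
    finally show ?thesis .
  qed
  have "is_pinv M ?X"
    unfolding is_pinv_def MX XM using M X FM FX symF by auto
  then show ?thesis ..
qed

lemma pinv_symmetric:
  assumes "M \<in> carrier_mat n n" "transpose_mat M = M"
  shows "is_pinv M (pinv M)"
proof -
  have "\<exists>!X. is_pinv M X"
    using is_pinv_symmetric_exists[OF assms] is_pinv_unique by blast
  then show ?thesis unfolding pinv_def is_pinv_def[symmetric] by (rule theI')
qed

text \<open>\<open>gram_ginverse\<close> cancels a Gram factor on one side of \<open>K\<close>, and
  transposing cancels it on the other. In least squares terms,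
  \<open>A * K * transpose_mat A\<close> fixes the range of \<open>A\<close>,
  \<open>K *\<^sub>v (transpose_mat A *\<^sub>v y)\<close> solves the normal equation, and
  \<open>K\<close> maps into the row space of \<open>A\<close>.\<close>

lemma pinv_gram:
  fixes A :: "real mat"
  assumes A: "A \<in> carrier_mat m n"
  defines "K \<equiv> pinv (transpose_mat A * A)"
  shows pinv_gram_carrier: "K \<in> carrier_mat n n"
    and mult_pinv_gram: "x \<in> carrier_vec n \<Longrightarrow> A *\<^sub>v (K *\<^sub>v (transpose_mat A *\<^sub>v (A *\<^sub>v x))) = A *\<^sub>v x"
    and pinv_gram_normal_equation: "y \<in> carrier_vec m \<Longrightarrow>
      transpose_mat A *\<^sub>v (A *\<^sub>v (K *\<^sub>v (transpose_mat A *\<^sub>v y))) = transpose_mat A *\<^sub>v y"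
    and pinv_gram_range: "x \<in> carrier_vec n \<Longrightarrow>
      \<exists>z\<in>carrier_vec m. K *\<^sub>v x = transpose_mat A *\<^sub>v z"
proof -
  let ?T = "transpose_mat A"
  let ?M = "?T * A"
  have M: "?M \<in> carrier_mat n n" and T: "?T \<in> carrier_mat n m" using A by auto
  have sym: "transpose_mat ?M = ?M" using transpose_mult[OF T A] by simp
  note pen = pinv_symmetric[OF M sym, folded K_def, unfolded is_pinv_def]
  show K: "K \<in> carrier_mat n n" using pen A by auto
  have MKM: "?M * K * ?M = ?M" and KMK: "K * ?M * K = K"
    and KM: "transpose_mat (K * ?M) = K * ?M" using pen by auto
  have AKM: "A * K * ?M = A" by (rule gram_ginverse[OF A K MKM])
  show "A *\<^sub>v (K *\<^sub>v (?T *\<^sub>v (A *\<^sub>v x))) = A *\<^sub>v x" if x: "x \<in> carrier_vec n" for x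
  proof -
    have "A *\<^sub>v x = (A * K * ?M) *\<^sub>v x" unfolding AKM ..
    also have "\<dots> = A *\<^sub>v (K *\<^sub>v (?T *\<^sub>v (A *\<^sub>v x)))"
      using A K T M x by (simp add: assoc_mult_mat_vec[of "A * K" m n ?M n] assoc_mult_mat_vec[of A m n K n])
    finally show ?thesis ..
  qed
  \<comment> \<open>The transpose of \<open>K\<close> is again a generalised inverse of the
    symmetric matrix \<open>?M\<close>. Cancelling with it and transposing gives the identity
    \<open>MKT\<close>.\<close>
  have tK: "transpose_mat K \<in> carrier_mat n n" using K by simp
  have "?M * transpose_mat K * ?M = transpose_mat (?M * K * ?M)"
    using M K tK by (simp add: transpose_mult[of _ n n _ n] sym)
  then have MtKM: "?M * transpose_mat K * ?M = ?M" using MKM sym by simp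
  have "A * transpose_mat K * ?M = A" by (rule gram_ginverse[OF A tK MtKM])
  from arg_cong[OF this, of transpose_mat] have MKT: "?M * (K * ?T) = ?T"
    using A M K tK by (simp add: transpose_mult[of "A * transpose_mat K" m n ?M n] transpose_mult[of A m n _ n] sym
        del: assoc_mult_mat)
  show "?T *\<^sub>v (A *\<^sub>v (K *\<^sub>v (?T *\<^sub>v y))) = ?T *\<^sub>v y" if y: "y \<in> carrier_vec m" for y
  proof -
    have "?T *\<^sub>v y = (?M * (K * ?T)) *\<^sub>v y" unfolding MKT ..
    also have "\<dots> = ?T *\<^sub>v (A *\<^sub>v (K *\<^sub>v (?T *\<^sub>v y)))"
      using A K T M y by (simp add: assoc_mult_mat_vec[of ?M n n "K * ?T" m] assoc_mult_mat_vec[of K n n ?T m] assoc_mult_mat_vec[of ?T n m A n])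
    finally show ?thesis ..
  qed
  show "\<exists>z\<in>carrier_vec m. K *\<^sub>v x = ?T *\<^sub>v z" if x: "x \<in> carrier_vec n" for x
  proof
    let ?z = "transpose_mat K *\<^sub>v (K *\<^sub>v x)"
    have z: "?z \<in> carrier_vec n" using K tK x by auto
    then show "A *\<^sub>v ?z \<in> carrier_vec m" using A by simp
    \<comment> \<open>Symmetry of \<open>K * ?M\<close> moves the Gram matrix to the front of
      \<open>K * ?M * K\<close>, which exposes a leading \<open>transpose_mat A\<close>.\<close>
    have "K * ?M = ?M * transpose_mat K"
      using KM transpose_mult[OF K M] sym by simp
    then have "K *\<^sub>v x = (?M * transpose_mat K * K) *\<^sub>v x" using KMK by simp
    also have "\<dots> = ?M *\<^sub>v ?z"
      using M tK K x by (simp add: assoc_mult_mat_vec[of "?M * transpose_mat K" n n K n] assoc_mult_mat_vec[of ?M n n "transpose_mat K" n]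
          del: assoc_mult_mat)
    also have "\<dots> = ?T *\<^sub>v (A *\<^sub>v ?z)" using T A z by (rule assoc_mult_mat_vec)
    finally show "K *\<^sub>v x = ?T *\<^sub>v (A *\<^sub>v ?z)" .
  qed
qed

section \<open>Norms and projections\<close>

lemma scalar_prod_self_add:
  fixes v w :: "real vec"
  assumes "v \<in> carrier_vec n" "w \<in> carrier_vec n"
  shows "(v + w) \<bullet> (v + w) = v \<bullet> v + 2 * (v \<bullet> w) + w \<bullet> w"
  using assms comm_scalar_prod[of v n w]
  by (simp add: add_scalar_prod_distrib[of _ n] scalar_prod_add_distrib[of _ n])

lemma vnorm_nonneg: "0 \<le> vnorm v"
  by (simp add: vnorm_def scalar_prod_self_nonneg)

lemma vnorm_square: "(vnorm v)\<^sup>2 = v \<bullet> v"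
  by (simp add: vnorm_def scalar_prod_self_nonneg)

lemma scalar_prod_Cauchy_Schwarz:
  fixes v w :: "real vec"
  assumes v: "v \<in> carrier_vec n" and w: "w \<in> carrier_vec n"
  shows "\<bar>v \<bullet> w\<bar> \<le> vnorm v * vnorm w"
proof (cases "w \<bullet> w = 0")
  case True
  then show ?thesis using scalar_prod_self_eq_0[OF w] v vnorm_nonneg[of v] vnorm_nonneg[of w] by simp
next
  case False
  then have pos: "w \<bullet> w > 0" using scalar_prod_self_nonneg[of w] by simp
  \<comment> \<open>\<open>?s\<close> minimises the squared norm of
    \<open>v + s \<cdot>\<^sub>v w\<close> over all \<open>s\<close>.\<close>
  let ?s = "- (v \<bullet> w / (w \<bullet> w))"
  have "0 \<le> (v + ?s \<cdot>\<^sub>v w) \<bullet> (v + ?s \<cdot>\<^sub>v w)" by (rule scalar_prod_self_nonneg)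
  also have "\<dots> = v \<bullet> v + 2 * (?s * (v \<bullet> w)) + ?s * (?s * (w \<bullet> w))"
    using v w by (subst scalar_prod_self_add[of _ n]) auto
  also have "\<dots> = v \<bullet> v - (v \<bullet> w)\<^sup>2 / (w \<bullet> w)" using pos by (simp add: field_simps power2_eq_square)
  finally have "(v \<bullet> w)\<^sup>2 \<le> (v \<bullet> v) * (w \<bullet> w)" using pos by (simp add: field_simps)
  also have "\<dots> = (vnorm v * vnorm w)\<^sup>2" by (simp add: power_mult_distrib vnorm_square)
  finally have "\<bar>v \<bullet> w\<bar> \<le> \<bar>vnorm v * vnorm w\<bar>" by (simp only: abs_le_square_iff)
  then show ?thesis using vnorm_nonneg[of v] vnorm_nonneg[of w] by simp
qed

text \<open>The constant is the squared Frobenius norm, by Cauchy-Schwarz in each row. This crude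
  bound comes first because the supremum in \<open>spectral_norm\<close> is an upper bound only once
  its set is known to be bounded.\<close>

lemma mult_mat_vec_bounded:
  fixes A :: "real mat"
  assumes A: "A \<in> carrier_mat m n"
  obtains C where "0 \<le> C" "\<And>x. x \<in> carrier_vec n \<Longrightarrow> (A *\<^sub>v x) \<bullet> (A *\<^sub>v x) \<le> C * (x \<bullet> x)"
proof
  let ?C = "\<Sum>i<m. row A i \<bullet> row A i"
  show "0 \<le> ?C" by (intro sum_nonneg scalar_prod_self_nonneg)
  fix x :: "real vec" assume x: "x \<in> carrier_vec n"
  have "(A *\<^sub>v x) \<bullet> (A *\<^sub>v x) = (\<Sum>i<m. (row A i \<bullet> x)\<^sup>2)"
    using A by (simp add: scalar_prod_def[of "A *\<^sub>v x"] atLeast0LessThan power2_eq_square)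
  also have "\<dots> \<le> (\<Sum>i<m. (row A i \<bullet> row A i) * (x \<bullet> x))"
  proof (rule sum_mono)
    fix i assume "i \<in> {..<m}"
    then have "row A i \<in> carrier_vec n" using A by auto
    from power_mono[OF scalar_prod_Cauchy_Schwarz[OF this x] abs_ge_zero, of 2]
    show "(row A i \<bullet> x)\<^sup>2 \<le> (row A i \<bullet> row A i) * (x \<bullet> x)"
      by (simp add: power_mult_distrib vnorm_square)
  qed
  finally show "(A *\<^sub>v x) \<bullet> (A *\<^sub>v x) \<le> ?C * (x \<bullet> x)" by (simp add: sum_distrib_right)
qed

lemma vnorm_smult: "vnorm (a \<cdot>\<^sub>v v) = \<bar>a\<bar> * vnorm v"
proof -
  have v: "v \<in> carrier_vec (dim_vec v)" by simp
  have "(a \<cdot>\<^sub>v v) \<bullet> (a \<cdot>\<^sub>v v) = a\<^sup>2 * (v \<bullet> v)" using v by (simp add: power2_eq_square)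
  then show ?thesis by (simp add: vnorm_def real_sqrt_mult)
qed

lemma spectral_norm_bounds:
  assumes A: "A \<in> carrier_mat m n"
  shows spectral_norm_nonneg: "0 \<le> spectral_norm A"
    and spectral_norm_bound: "x \<in> carrier_vec n \<Longrightarrow> vnorm (A *\<^sub>v x) \<le> spectral_norm A * vnorm x"
proof -
  let ?S = "{vnorm (A *\<^sub>v x) | x. x \<in> carrier_vec (dim_col A) \<and> vnorm x \<le> 1}"
  obtain C where C: "0 \<le> C" "\<And>x. x \<in> carrier_vec n \<Longrightarrow> (A *\<^sub>v x) \<bullet> (A *\<^sub>v x) \<le> C * (x \<bullet> x)"
    using mult_mat_vec_bounded[OF A] by blast
  have bdd: "bdd_above ?S"
  proof (rule bdd_aboveI)
    fix r assume "r \<in> ?S"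
    then obtain x where x: "x \<in> carrier_vec n" "vnorm x \<le> 1" and r: "r = vnorm (A *\<^sub>v x)"
      using A by auto
    have "r \<le> sqrt (C * (x \<bullet> x))" unfolding r vnorm_def[of "A *\<^sub>v x"] using C(2)[OF x(1)] by simp
    also have "\<dots> = sqrt C * vnorm x" by (simp add: real_sqrt_mult vnorm_def)
    also have "\<dots> \<le> sqrt C" using x(2) C(1) vnorm_nonneg[of x] by (simp add: mult_left_le)
    finally show "r \<le> sqrt C" .
  qed
  have upper: "vnorm (A *\<^sub>v x) \<le> spectral_norm A" if "x \<in> carrier_vec n" "vnorm x \<le> 1" for x
    unfolding spectral_norm_def using that A bdd by (intro cSup_upper) auto
  \<comment> \<open>The zero vector lies in the unit ball, so the supremum is at least the
    nonnegative value attained there.\<close>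
  have "vnorm (0\<^sub>v n) \<le> 1" by (simp add: vnorm_def)
  from order_trans[OF vnorm_nonneg upper[OF _ this]] show "0 \<le> spectral_norm A" by simp
  show "vnorm (A *\<^sub>v x) \<le> spectral_norm A * vnorm x" if x: "x \<in> carrier_vec n"
  proof (cases "vnorm x = 0")
    case True
    then have "x = 0\<^sub>v n" using x scalar_prod_self_eq_0 by (simp add: vnorm_def)
    then have "A *\<^sub>v x = 0\<^sub>v m" using A by auto
    then show ?thesis using True by (simp add: vnorm_def)
  next
    case False
    then have pos: "0 < vnorm x" using vnorm_nonneg[of x] by simp
    have "A *\<^sub>v ((1 / vnorm x) \<cdot>\<^sub>v x) = (1 / vnorm x) \<cdot>\<^sub>v (A *\<^sub>v x)"
      using A x by (rule mult_mat_vec)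
    moreover have "vnorm (A *\<^sub>v ((1 / vnorm x) \<cdot>\<^sub>v x)) \<le> spectral_norm A"
      using pos x by (intro upper) (auto simp: vnorm_smult)
    ultimately have "vnorm (A *\<^sub>v x) / vnorm x \<le> spectral_norm A"
      using pos by (simp add: vnorm_smult)
    then show ?thesis using pos by (simp add: field_simps)
  qed
qed

section \<open>Euclidean projections onto kernels and onto the orthant\<close>

lemma euclid_proj_eqI:
  assumes S: "S \<subseteq> carrier_vec n" and x: "x \<in> carrier_vec n" and p: "p \<in> S"
    and obtuse: "\<And>q. q \<in> S \<Longrightarrow> (x - p) \<bullet> (q - p) \<le> 0"
  shows "euclid_proj S x = p"
proof -
  have pc: "p \<in> carrier_vec n" using S p by auto
  \<comment> \<open>The obtuse angle turns Pythagoras into an inequality. It gives minimality of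
    \<open>p\<close> and, through the extra term in \<open>q - p\<close>, uniqueness.\<close>
  have key: "(x - p) \<bullet> (x - p) + (q - p) \<bullet> (q - p) \<le> (x - q) \<bullet> (x - q)" if q: "q \<in> S" for q
  proof -
    have qc: "q \<in> carrier_vec n" using S q by auto
    have "x - q = (x - p) + (-1) \<cdot>\<^sub>v (q - p)" using x pc qc by (intro eq_vecI) auto
    then have "(x - q) \<bullet> (x - q) = (x - p) \<bullet> (x - p) - 2 * ((x - p) \<bullet> (q - p)) + (q - p) \<bullet> (q - p)"
      using x pc qc by (simp add: scalar_prod_self_add[of _ n])
    then show ?thesis using obtuse[OF q] by simp
  qed
  show ?thesis unfolding euclid_proj_def
  proof (rule the_equality)
    show "p \<in> S \<and> (\<forall>q\<in>S. vnorm (x - p) \<le> vnorm (x - q))"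
      using p key order_trans[OF le_add_same_cancel1[THEN iffD2, OF scalar_prod_self_nonneg] key]
      by (simp add: vnorm_def)
    fix q assume q: "q \<in> S \<and> (\<forall>r\<in>S. vnorm (x - q) \<le> vnorm (x - r))"
    then have "(x - q) \<bullet> (x - q) \<le> (x - p) \<bullet> (x - p)" using p by (simp add: vnorm_def)
    then have "(q - p) \<bullet> (q - p) = 0" using key[of q] q scalar_prod_self_nonneg[of "q - p"] by simp
    moreover have qc: "q \<in> carrier_vec n" using S q by auto
    ultimately have z: "q - p = 0\<^sub>v n" using pc by (intro scalar_prod_self_eq_0) auto
    show "q = p"
    proof (rule eq_vecI)
      fix i assume "i < dim_vec p"
      then show "q $ i = p $ i" using arg_cong[OF z, of "\<lambda>v. v $ i"] pc by simp
    qed (use pc qc in simp)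
  qed
qed

text \<open>The subtracted vector lies in the range of \<open>transpose_mat A\<close>, hence is
  orthogonal to the kernel, and the normal equation puts the difference into the kernel. The angle
  condition of \<open>euclid_proj_eqI\<close> then holds with equality.\<close>

lemma euclid_proj_mat_kernel:
  fixes A :: "real mat"
  assumes A: "A \<in> carrier_mat m n" and x: "x \<in> carrier_vec n"
  shows "euclid_proj (mat_kernel A) x
    = x - transpose_mat A *\<^sub>v (pinv (A * transpose_mat A) *\<^sub>v (A *\<^sub>v x))"
proof -
  let ?T = "transpose_mat A"
  let ?h = "pinv (A * ?T) *\<^sub>v (A *\<^sub>v x)"
  have T: "?T \<in> carrier_mat n m" using A by simp
  have h: "?h \<in> carrier_vec m" and Ax: "A *\<^sub>v x \<in> carrier_vec m" using pinv_gram_carrier[OF T] A x by auto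
  have Th: "?T *\<^sub>v ?h \<in> carrier_vec n" using T h by (rule mult_mat_vec_carrier)
  let ?p = "x - ?T *\<^sub>v ?h"
  have p: "?p \<in> carrier_vec n" using x Th by simp
  have "A *\<^sub>v ?p = A *\<^sub>v x - A *\<^sub>v (?T *\<^sub>v ?h)" by (rule mult_minus_distrib_mat_vec[OF A x Th])
  also have "A *\<^sub>v (?T *\<^sub>v ?h) = A *\<^sub>v x" using pinv_gram_normal_equation[OF T x] by simp
  also have "A *\<^sub>v x - A *\<^sub>v x = 0\<^sub>v m" using Ax by auto
  finally have Ap: "A *\<^sub>v ?p = 0\<^sub>v m" .
  show ?thesis
  proof (rule euclid_proj_eqI)
    show "mat_kernel A \<subseteq> carrier_vec n" using A by (auto simp: mat_kernel_def)
    show "?p \<in> mat_kernel A" by (rule mat_kernelI[OF A p Ap])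
    show "x \<in> carrier_vec n" by fact
    fix q assume "q \<in> mat_kernel A"
    then have q: "q \<in> carrier_vec n" "A *\<^sub>v q = 0\<^sub>v m" using mat_kernelD[OF A] by auto
    have qp: "q - ?p \<in> carrier_vec n" using q p by simp
    have "x - ?p = ?T *\<^sub>v ?h" using x Th by (intro eq_vecI) auto
    then have "(x - ?p) \<bullet> (q - ?p) = ?h \<bullet> (A *\<^sub>v (q - ?p))"
      using transpose_vec_mult_scalar[OF A qp h] by simp
    also have "A *\<^sub>v (q - ?p) = A *\<^sub>v q - A *\<^sub>v ?p" by (rule mult_minus_distrib_mat_vec[OF A q(1) p])
    also have "\<dots> = 0\<^sub>v m" unfolding q(2) Ap by simp
    finally show "(x - ?p) \<bullet> (q - ?p) \<le> 0" using h by simp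
  qed
qed

lemma euclid_proj_nonneg_orthant:
  assumes x: "x \<in> carrier_vec n"
  shows "euclid_proj (nonneg_orthant n) x = vec n (\<lambda>i. max 0 (x $ i))"
proof (rule euclid_proj_eqI[OF _ x])
  fix q assume q: "q \<in> nonneg_orthant n"
  let ?p = "vec n (\<lambda>i. max 0 (x $ i))"
  have "(x - ?p) \<bullet> (q - ?p) = (\<Sum>i<n. (x $ i - max 0 (x $ i)) * (q $ i - max 0 (x $ i)))"
    using x q by (simp add: scalar_prod_def nonneg_orthant_def atLeast0LessThan)
  \<comment> \<open>A summand vanishes if \<open>x $ i\<close> is nonnegative; otherwise it is
    \<open>x $ i * q $ i\<close> with a negative first and a nonnegative second factor.\<close>
  also have "\<dots> \<le> 0"
    using q by (intro sum_nonpos) (auto simp: nonneg_orthant_def max_def mult_le_0_iff)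
  finally show "(x - ?p) \<bullet> (q - ?p) \<le> 0" .
qed (auto simp: nonneg_orthant_def)

section \<open>The linear part of the iteration\<close>

lemma mult_mat_vec_carrier_row: "A \<in> carrier_mat m n \<Longrightarrow> A *\<^sub>v x \<in> carrier_vec m"
  by (intro carrier_vecI) simp

text \<open>The quadratic form of the metric \<open>[[I, \<eta> A\<^sup>T], [\<eta> A, I]]\<close>, in which a PDHG step without
  projection is the resolvent of the skew operator \<open>(x, y) \<mapsto> (- A\<^sup>T y, A x)\<close>.\<close>

definition pdhg_energy :: "real mat \<Rightarrow> real \<Rightarrow> real vec \<Rightarrow> real vec \<Rightarrow> real" where
  "pdhg_energy A \<eta> u t = u \<bullet> u + t \<bullet> t + 2 * \<eta> * (t \<bullet> (A *\<^sub>v u))"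

text \<open>Cauchy-Schwarz and \<open>2 * a * b \<le> a\<^sup>2 + b\<^sup>2\<close> bound the cross
  term by \<open>\<eta> * \<sigma>\<close> times the sum of the squared norms.\<close>

lemma pdhg_energy_coercive:
  assumes A: "A \<in> carrier_mat m n" and u: "u \<in> carrier_vec n" and t: "t \<in> carrier_vec m"
    and \<eta>: "0 \<le> \<eta>" and \<sigma>: "0 \<le> \<sigma>" "vnorm (A *\<^sub>v u) \<le> \<sigma> * vnorm u"
  shows "(1 - \<eta> * \<sigma>) * (u \<bullet> u + t \<bullet> t) \<le> pdhg_energy A \<eta> u t"
proof -
  have Au: "A *\<^sub>v u \<in> carrier_vec m" using A by (rule mult_mat_vec_carrier_row)
  have "\<bar>t \<bullet> (A *\<^sub>v u)\<bar> \<le> vnorm t * vnorm (A *\<^sub>v u)"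
    by (rule scalar_prod_Cauchy_Schwarz[OF t Au])
  also have "\<dots> \<le> vnorm t * (\<sigma> * vnorm u)"
    by (rule mult_left_mono[OF \<sigma>(2) vnorm_nonneg])
  finally have "2 * \<bar>t \<bullet> (A *\<^sub>v u)\<bar> \<le> \<sigma> * (2 * vnorm u * vnorm t)" by (simp add: mult_ac)
  also have "\<dots> \<le> \<sigma> * ((vnorm u)\<^sup>2 + (vnorm t)\<^sup>2)"
    by (rule mult_left_mono[OF sum_squares_bound \<sigma>(1)])
  finally have "\<eta> * (2 * \<bar>t \<bullet> (A *\<^sub>v u)\<bar>) \<le> \<eta> * (\<sigma> * (u \<bullet> u + t \<bullet> t))"
    unfolding vnorm_square by (rule mult_left_mono[OF _ \<eta>])
  moreover have "- (\<eta> * (2 * \<bar>s\<bar>)) \<le> 2 * \<eta> * s" for s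
    using mult_left_mono[OF abs_ge_minus_self[of s] \<eta>] by (simp add: algebra_simps)
  note this[of "t \<bullet> (A *\<^sub>v u)"]
  moreover have "(1 - \<eta> * \<sigma>) * S = S - \<eta> * (\<sigma> * S)" for S
    by (simp add: left_diff_distrib)
  note this[of "u \<bullet> u + t \<bullet> t"]
  ultimately show ?thesis unfolding pdhg_energy_def by linarith
qed

text \<open>The decrement of the energy is again an energy, evaluated at the vectors that measure how far
  \<open>(u, t)\<close> is from being a fixed point.\<close>

lemma pdhg_energy_step:
  assumes A: "A \<in> carrier_mat m n" and u: "u \<in> carrier_vec n" and t: "t \<in> carrier_vec m"
  defines "a \<equiv> transpose_mat A *\<^sub>v t"
  defines "p \<equiv> A *\<^sub>v u"
  shows "pdhg_energy A \<eta> (u + \<eta> \<cdot>\<^sub>v a) (t + ((- \<eta>) \<cdot>\<^sub>v p + (- 2 * \<eta>\<^sup>2) \<cdot>\<^sub>v (A *\<^sub>v a)))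
    = pdhg_energy A \<eta> u t - \<eta>\<^sup>2 * pdhg_energy A \<eta> a p"
proof -
  define q where "q = A *\<^sub>v a"
  have a: "a \<in> carrier_vec n" and p: "p \<in> carrier_vec m" and q: "q \<in> carrier_vec m"
    unfolding a_def p_def q_def using A by (auto intro!: mult_mat_vec_carrier_row)
  have Au': "A *\<^sub>v (u + \<eta> \<cdot>\<^sub>v a) = p + \<eta> \<cdot>\<^sub>v q"
    using A u a by (simp add: mult_add_distrib_mat_vec[of A m n] mult_mat_vec[of A m n] p_def q_def)
  \<comment> \<open>Adjointness leaves \<open>t \<bullet> p\<close>, \<open>t \<bullet> q\<close>
    and \<open>p \<bullet> q\<close> as the only mixed products, with
    \<open>a \<bullet> a = t \<bullet> q\<close>. In these and the remaining squared norms the claim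
    is a polynomial identity.\<close>
  have au: "a \<bullet> u = t \<bullet> p" unfolding a_def p_def by (rule transpose_vec_mult_scalar[OF A u t])
  have ua: "u \<bullet> a = t \<bullet> p" using comm_scalar_prod[OF u a] au by simp
  have aa: "a \<bullet> a = t \<bullet> q"
    using transpose_vec_mult_scalar[OF A a t] unfolding a_def[symmetric] q_def[symmetric] .
  have "p \<bullet> t = t \<bullet> p" "q \<bullet> t = t \<bullet> q" "q \<bullet> p = p \<bullet> q"
    using comm_scalar_prod t p q by blast+
  then show ?thesis
    unfolding pdhg_energy_def Au' q_def[symmetric] p_def[symmetric]
    using u t a p q
    by (simp add: add_scalar_prod_distrib[of _ n] scalar_prod_add_distrib[of _ n]
        add_scalar_prod_distrib[of _ m] scalar_prod_add_distrib[of _ m] ua au aa)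
      (simp add: algebra_simps power2_eq_square)
qed

text \<open>On the range of \<open>transpose_mat A\<close> the matrix \<open>A\<close> has the left
  inverse \<open>transpose_mat A * pinv (A * transpose_mat A)\<close>, and a bound for this inverse
  bounds \<open>A\<close> from below there.\<close>

lemma scalar_prod_self_le_of_range:
  fixes A :: "real mat"
  assumes A: "A \<in> carrier_mat m n"
  obtains C where "0 \<le> C" "\<And>q. q \<in> carrier_vec m \<Longrightarrow>
    (transpose_mat A *\<^sub>v q) \<bullet> (transpose_mat A *\<^sub>v q)
      \<le> C * ((A *\<^sub>v (transpose_mat A *\<^sub>v q)) \<bullet> (A *\<^sub>v (transpose_mat A *\<^sub>v q)))"
proof -
  let ?T = "transpose_mat A"
  let ?H = "pinv (A * ?T)"
  have T: "?T \<in> carrier_mat n m" using A by simp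
  have H: "?H \<in> carrier_mat m m" using pinv_gram_carrier[OF T] by simp
  have TH: "?T * ?H \<in> carrier_mat n m" using T H by simp
  from mult_mat_vec_bounded[OF TH] obtain C where C: "0 \<le> C"
    "\<And>x. x \<in> carrier_vec m \<Longrightarrow> ((?T * ?H) *\<^sub>v x) \<bullet> ((?T * ?H) *\<^sub>v x) \<le> C * (x \<bullet> x)" by blast
  have "(?T *\<^sub>v q) \<bullet> (?T *\<^sub>v q) \<le> C * ((A *\<^sub>v (?T *\<^sub>v q)) \<bullet> (A *\<^sub>v (?T *\<^sub>v q)))"
    if q: "q \<in> carrier_vec m" for q
  proof -
    have r: "A *\<^sub>v (?T *\<^sub>v q) \<in> carrier_vec m" using A by (rule mult_mat_vec_carrier_row)
    have "(?T * ?H) *\<^sub>v (A *\<^sub>v (?T *\<^sub>v q)) = ?T *\<^sub>v q"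
      using mult_pinv_gram[OF T q] assoc_mult_mat_vec[OF T H r] by simp
    then show ?thesis using C(2)[OF r] by simp
  qed
  then show thesis using that C(1) by blast
qed

text \<open>\<open>\<sigma>\<close> may be any bound for \<open>A\<close>, so that the norm of the
  full constraint matrix can serve for its column submatrix. The range hypotheses exclude nonzero
  fixed points: vectors in the kernels of \<open>A\<close> and its transpose would not
  decay.\<close>

lemma pdhg_energy_decay:
  fixes u t :: "nat \<Rightarrow> real vec"
  assumes A: "A \<in> carrier_mat m n"
    and \<eta>: "0 < \<eta>" and \<sigma>: "0 \<le> \<sigma>" "\<eta> * \<sigma> < 1"
    and bound: "\<And>x. x \<in> carrier_vec n \<Longrightarrow> vnorm (A *\<^sub>v x) \<le> \<sigma> * vnorm x"
    and u: "\<And>k. \<exists>q\<in>carrier_vec m. u k = transpose_mat A *\<^sub>v q"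
    and t: "\<And>k. \<exists>q\<in>carrier_vec n. t k = A *\<^sub>v q"
    and step_u: "\<And>k. u (Suc k) = u k + \<eta> \<cdot>\<^sub>v (transpose_mat A *\<^sub>v t k)"
    and step_t: "\<And>k. t (Suc k) = t k + ((- \<eta>) \<cdot>\<^sub>v (A *\<^sub>v u k)
      + (- 2 * \<eta>\<^sup>2) \<cdot>\<^sub>v (A *\<^sub>v (transpose_mat A *\<^sub>v t k)))"
  shows "(\<lambda>k. u k \<bullet> u k + t k \<bullet> t k) \<longlonglongrightarrow> 0"
proof -
  let ?T = "transpose_mat A"
  define E where "E k = pdhg_energy A \<eta> (u k) (t k)" for k
  \<comment> \<open>The factor \<open>\<eta>\<^sup>2\<close> comes from the energy decrement, the
    other one from coercivity.\<close>
  define \<delta> where "\<delta> = \<eta>\<^sup>2 * (1 - \<eta> * \<sigma>)"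
  have \<delta>: "0 < \<delta>" using \<eta> \<sigma> by (simp add: \<delta>_def)
  have T: "?T \<in> carrier_mat n m" using A by simp
  have uc: "u k \<in> carrier_vec n" and tc: "t k \<in> carrier_vec m" for k
    using u[of k] t[of k] A by auto
  obtain C1 where C1: "0 \<le> C1" "\<And>k. u k \<bullet> u k \<le> C1 * ((A *\<^sub>v u k) \<bullet> (A *\<^sub>v u k))"
    using scalar_prod_self_le_of_range[OF A] u by metis
  \<comment> \<open>The range inequality for the transposed matrix, whose transposed range is that
    of \<open>A\<close>.\<close>
  obtain C2 where C2: "0 \<le> C2" "\<And>k. t k \<bullet> t k \<le> C2 * ((?T *\<^sub>v t k) \<bullet> (?T *\<^sub>v t k))"
    using scalar_prod_self_le_of_range[OF T] t unfolding transpose_transpose by metis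
  have drop: "\<delta> * ((?T *\<^sub>v t k) \<bullet> (?T *\<^sub>v t k) + (A *\<^sub>v u k) \<bullet> (A *\<^sub>v u k)) \<le> E k - E (Suc k)" for k
  proof -
    have c: "?T *\<^sub>v t k \<in> carrier_vec n" "A *\<^sub>v u k \<in> carrier_vec m"
      using A T by (auto intro!: mult_mat_vec_carrier_row)
    have "E k - E (Suc k) = \<eta>\<^sup>2 * pdhg_energy A \<eta> (?T *\<^sub>v t k) (A *\<^sub>v u k)"
      unfolding E_def step_u step_t pdhg_energy_step[OF A uc tc] by simp
    moreover have "(1 - \<eta> * \<sigma>) * ((?T *\<^sub>v t k) \<bullet> (?T *\<^sub>v t k) + (A *\<^sub>v u k) \<bullet> (A *\<^sub>v u k))
        \<le> pdhg_energy A \<eta> (?T *\<^sub>v t k) (A *\<^sub>v u k)"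
      using \<eta> \<sigma>(1) by (intro pdhg_energy_coercive[OF A c] bound c) auto
    ultimately show ?thesis unfolding \<delta>_def mult.assoc by (simp add: mult_left_mono)
  qed
  have dec: "decseq E"
  proof (rule decseq_SucI)
    fix k
    have "0 \<le> \<delta> * ((?T *\<^sub>v t k) \<bullet> (?T *\<^sub>v t k) + (A *\<^sub>v u k) \<bullet> (A *\<^sub>v u k))"
      using \<delta> by (simp add: scalar_prod_self_nonneg)
    then show "E (Suc k) \<le> E k" using drop[of k] by simp
  qed
  have low: "0 \<le> E k" for k
  proof -
    have "0 \<le> (1 - \<eta> * \<sigma>) * (u k \<bullet> u k + t k \<bullet> t k)"
      using \<sigma> by (simp add: scalar_prod_self_nonneg)
    also have "\<dots> \<le> E k" unfolding E_def
      using \<eta> \<sigma>(1) by (intro pdhg_energy_coercive[OF A uc tc] bound uc) auto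
    finally show ?thesis .
  qed
  obtain l where l: "E \<longlonglongrightarrow> l" using decseq_convergent[OF dec, of 0] low by blast
  \<comment> \<open>The energies converge, so their successive differences tend to
    \<open>l - l\<close>. This multiple of them is the upper end of the final sandwich.\<close>
  have diff: "(\<lambda>k. (C1 + C2) / \<delta> * (E k - E (Suc k))) \<longlonglongrightarrow> (C1 + C2) / \<delta> * (l - l)"
    by (intro tendsto_intros l LIMSEQ_Suc)
  have le: "u k \<bullet> u k + t k \<bullet> t k \<le> (C1 + C2) / \<delta> * (E k - E (Suc k))" for k
  proof -
    let ?p = "(A *\<^sub>v u k) \<bullet> (A *\<^sub>v u k)" and ?a = "(?T *\<^sub>v t k) \<bullet> (?T *\<^sub>v t k)"
    have "u k \<bullet> u k + t k \<bullet> t k \<le> C1 * ?p + C2 * ?a" using C1(2)[of k] C2(2)[of k] by simp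
    also have "\<dots> \<le> (C1 + C2) * (?a + ?p)"
      using C1(1) C2(1) by (simp add: algebra_simps scalar_prod_self_nonneg)
    also have "\<dots> = (C1 + C2) / \<delta> * (\<delta> * (?a + ?p))" using \<delta> by simp
    also have "\<dots> \<le> (C1 + C2) / \<delta> * (E k - E (Suc k))"
      using \<delta> C1(1) C2(1) by (intro mult_left_mono drop) auto
    finally show ?thesis .
  qed
  show ?thesis
    by (rule tendsto_sandwich[OF _ _ tendsto_const, where h = "\<lambda>k. (C1 + C2) / \<delta> * (E k - E (Suc k))"])
      (use le diff in \<open>auto simp: scalar_prod_self_nonneg\<close>)
qed

section \<open>The matrix \<open>P_mat\<close> and its powers on the range space\<close>

lemma P_mat_carrier: "A \<in> carrier_mat m n \<Longrightarrow> P_mat A \<eta> \<in> carrier_mat (n + m) (n + m)"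
  unfolding P_mat_def by (rule four_block_carrier_mat) auto

text \<open>The lower block is arranged as in \<open>pdhg_energy_step\<close>, so that the powers of
  \<open>P_mat\<close> and the energy identity share one recursion.\<close>

lemma P_mat_mult_append:
  fixes A :: "real mat"
  assumes A: "A \<in> carrier_mat m n" and u: "u \<in> carrier_vec n" and t: "t \<in> carrier_vec m"
  shows "P_mat A \<eta> *\<^sub>v (u @\<^sub>v t) = (u + \<eta> \<cdot>\<^sub>v (transpose_mat A *\<^sub>v t))
    @\<^sub>v (t + ((- \<eta>) \<cdot>\<^sub>v (A *\<^sub>v u) + (- 2 * \<eta>\<^sup>2) \<cdot>\<^sub>v (A *\<^sub>v (transpose_mat A *\<^sub>v t))))"
proof -
  let ?T = "transpose_mat A"
  have T: "?T \<in> carrier_mat n m" and AT: "A * ?T \<in> carrier_mat m m" using A by auto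
  have sm: "(k \<cdot>\<^sub>m M) *\<^sub>v v = k \<cdot>\<^sub>v (M *\<^sub>v v)" if "M \<in> carrier_mat r s" "v \<in> carrier_vec s"
    for k :: real and M r s v
    using that by (intro eq_vecI) auto
  have "(1\<^sub>m m - (2 * \<eta>\<^sup>2) \<cdot>\<^sub>m (A * ?T)) *\<^sub>v t = 1\<^sub>m m *\<^sub>v t - ((2 * \<eta>\<^sup>2) \<cdot>\<^sub>m (A * ?T)) *\<^sub>v t"
    using AT t by (intro minus_mult_distrib_mat_vec) auto
  then have D: "(1\<^sub>m m - (2 * \<eta>\<^sup>2) \<cdot>\<^sub>m (A * ?T)) *\<^sub>v t = t - (2 * \<eta>\<^sup>2) \<cdot>\<^sub>v (A *\<^sub>v (?T *\<^sub>v t))"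
    using t A T by (simp add: sm[OF AT])
  have "P_mat A \<eta> *\<^sub>v (u @\<^sub>v t) = (1\<^sub>m n *\<^sub>v u + (\<eta> \<cdot>\<^sub>m ?T) *\<^sub>v t)
      @\<^sub>v (((- \<eta>) \<cdot>\<^sub>m A) *\<^sub>v u + (1\<^sub>m m - (2 * \<eta>\<^sup>2) \<cdot>\<^sub>m (A * ?T)) *\<^sub>v t)"
    unfolding P_mat_def using A u t
    by (subst four_block_mat_mult_vec[of _ n n _ m _ m]) auto
  also have "\<dots> = (u + \<eta> \<cdot>\<^sub>v (?T *\<^sub>v t))
    @\<^sub>v (t + ((- \<eta>) \<cdot>\<^sub>v (A *\<^sub>v u) + (- 2 * \<eta>\<^sup>2) \<cdot>\<^sub>v (A *\<^sub>v (?T *\<^sub>v t))))"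
  proof -
    have "(- \<eta>) \<cdot>\<^sub>v (A *\<^sub>v u) + (t - (2 * \<eta>\<^sup>2) \<cdot>\<^sub>v (A *\<^sub>v (?T *\<^sub>v t)))
      = t + ((- \<eta>) \<cdot>\<^sub>v (A *\<^sub>v u) + (- 2 * \<eta>\<^sup>2) \<cdot>\<^sub>v (A *\<^sub>v (?T *\<^sub>v t)))"
      using A t by (intro eq_vecI) (auto simp del: index_mult_mat_vec)
    then show ?thesis unfolding D sm[OF A u] sm[OF T t] using u by simp
  qed
  finally show ?thesis .
qed

text \<open>\<open>pow_mat\<close> puts the new factor on the right, whereas a step of the iteration
  applies it on the left.\<close>

lemma pow_mat_Suc_mult_vec:
  assumes M: "M \<in> carrier_mat n n" and v: "v \<in> carrier_vec n"
  shows "M ^\<^sub>m Suc k *\<^sub>v v = M *\<^sub>v (M ^\<^sub>m k *\<^sub>v v)"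
proof -
  have "M ^\<^sub>m Suc k = M * M ^\<^sub>m k"
  proof (induction k)
    case (Suc k)
    have "M ^\<^sub>m Suc (Suc k) = (M * M ^\<^sub>m k) * M" using Suc.IH by simp
    also have "\<dots> = M * (M ^\<^sub>m k * M)" using M by (intro assoc_mult_mat) auto
    finally show ?case by simp
  qed (use M in simp)
  then show ?thesis using assoc_mult_mat_vec[OF M pow_carrier_mat[OF M] v] by simp
qed

text \<open>The increments of the two blocks are images under \<open>transpose_mat A\<close> and
  \<open>A\<close>, so a pair that starts in the two ranges stays there. Naming the blocks as
  sequences matches the hypotheses of \<open>pdhg_energy_decay\<close>.\<close>

lemma P_mat_power_on_range:
  fixes A :: "real mat"
  assumes A: "A \<in> carrier_mat m n"
    and q: "q \<in> carrier_vec m" and r: "r \<in> carrier_vec n"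
  obtains u t where
    "\<And>k. P_mat A \<eta> ^\<^sub>m k *\<^sub>v ((transpose_mat A *\<^sub>v q) @\<^sub>v (A *\<^sub>v r)) = u k @\<^sub>v t k"
    "\<And>k. \<exists>q\<in>carrier_vec m. u k = transpose_mat A *\<^sub>v q"
    "\<And>k. \<exists>r\<in>carrier_vec n. t k = A *\<^sub>v r"
    "\<And>k. u (Suc k) = u k + \<eta> \<cdot>\<^sub>v (transpose_mat A *\<^sub>v t k)"
    "\<And>k. t (Suc k) = t k + ((- \<eta>) \<cdot>\<^sub>v (A *\<^sub>v u k)
      + (- 2 * \<eta>\<^sup>2) \<cdot>\<^sub>v (A *\<^sub>v (transpose_mat A *\<^sub>v t k)))"
proof -
  let ?T = "transpose_mat A"
  let ?P = "P_mat A \<eta>"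
  let ?F = "\<lambda>(u, t). (u + \<eta> \<cdot>\<^sub>v (?T *\<^sub>v t),
    t + ((- \<eta>) \<cdot>\<^sub>v (A *\<^sub>v u) + (- 2 * \<eta>\<^sup>2) \<cdot>\<^sub>v (A *\<^sub>v (?T *\<^sub>v t))))"
  define z where "z k = (?F ^^ k) (?T *\<^sub>v q, A *\<^sub>v r)" for k
  define u where "u k = fst (z k)" for k
  define t where "t k = snd (z k)" for k
  have T: "?T \<in> carrier_mat n m" using A by simp
  have P: "?P \<in> carrier_mat (n + m) (n + m)" by (rule P_mat_carrier[OF A])
  have step: "u (Suc k) = u k + \<eta> \<cdot>\<^sub>v (?T *\<^sub>v t k)"
    "t (Suc k) = t k + ((- \<eta>) \<cdot>\<^sub>v (A *\<^sub>v u k) + (- 2 * \<eta>\<^sup>2) \<cdot>\<^sub>v (A *\<^sub>v (?T *\<^sub>v t k)))" for k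
    unfolding u_def t_def z_def by (simp_all add: case_prod_beta)
  have range: "(\<exists>q\<in>carrier_vec m. u k = ?T *\<^sub>v q) \<and> (\<exists>r\<in>carrier_vec n. t k = A *\<^sub>v r)" for k
  proof (induction k)
    case 0
    then show ?case using q r by (auto simp: u_def t_def z_def)
  next
    case (Suc k)
    then obtain q' r' where q': "q' \<in> carrier_vec m" "u k = ?T *\<^sub>v q'"
      and r': "r' \<in> carrier_vec n" "t k = A *\<^sub>v r'" by blast
    have c: "t k \<in> carrier_vec m" "u k \<in> carrier_vec n" "?T *\<^sub>v t k \<in> carrier_vec n" using A q' r' by auto
    \<comment> \<open>The preimages are updated along with the blocks: the increment is pulled back
      through \<open>?T\<close> here and through \<open>A\<close> below.\<close>
    have "u (Suc k) = ?T *\<^sub>v (q' + \<eta> \<cdot>\<^sub>v t k)"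
      unfolding step(1) using T q' c
      by (simp add: mult_add_distrib_mat_vec[of ?T n m] mult_mat_vec[of ?T n m])
    moreover have "t (Suc k) = A *\<^sub>v (r' + ((- \<eta>) \<cdot>\<^sub>v u k + (- 2 * \<eta>\<^sup>2) \<cdot>\<^sub>v (?T *\<^sub>v t k)))"
      unfolding step(2) using A r' c
      by (simp add: mult_add_distrib_mat_vec[of A m n] mult_mat_vec[of A m n])
    moreover have "q' + \<eta> \<cdot>\<^sub>v t k \<in> carrier_vec m"
      "r' + ((- \<eta>) \<cdot>\<^sub>v u k + (- 2 * \<eta>\<^sup>2) \<cdot>\<^sub>v (?T *\<^sub>v t k)) \<in> carrier_vec n"
      using q' r' c by auto
    ultimately show ?case by (intro conjI bexI)
  qed
  have carr: "u k \<in> carrier_vec n" "t k \<in> carrier_vec m" for k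
    using range[of k] A by auto
  have "?P ^\<^sub>m k *\<^sub>v ((?T *\<^sub>v q) @\<^sub>v (A *\<^sub>v r)) = u k @\<^sub>v t k" for k
  proof (induction k)
    case 0
    have "(?T *\<^sub>v q) @\<^sub>v (A *\<^sub>v r) \<in> carrier_vec (n + m)" using carr[of 0] by (simp add: u_def t_def z_def)
    then show ?case using P by (simp add: u_def t_def z_def)
  next
    case (Suc k)
    have "(?T *\<^sub>v q) @\<^sub>v (A *\<^sub>v r) \<in> carrier_vec (n + m)" using carr[of 0] by (simp add: u_def t_def z_def)
    then show ?case
      using P_mat_mult_append[OF A carr] by (simp add: pow_mat_Suc_mult_vec[OF P] Suc.IH step del: pow_mat.simps)
  qed
  moreover have "\<exists>q\<in>carrier_vec m. u k = ?T *\<^sub>v q" "\<exists>r\<in>carrier_vec n. t k = A *\<^sub>v r" for k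
    using range by auto
  ultimately show thesis by (rule that[of u t, OF _ _ _ step])
qed

text \<open>One statement serves both halves of the spiral center: the dual half arises by replacing
  \<open>A\<close> with its transpose and \<open>b\<close> with the cost vector. The kernel
  projection leaves the residual unchanged, and subtracting it from \<open>x\<close> leaves only a
  vector in the range of \<open>transpose_mat A\<close>.\<close>

lemma least_squares_center:
  fixes A :: "real mat"
  assumes A: "A \<in> carrier_mat m n" and b: "b \<in> carrier_vec m" and x: "x \<in> carrier_vec n"
  defines "K \<equiv> pinv (transpose_mat A * A)"
  defines "X \<equiv> K *\<^sub>v (transpose_mat A *\<^sub>v b) + euclid_proj (mat_kernel A) x"
  shows least_squares_center_carrier: "X \<in> carrier_vec n"
    and mult_least_squares_center: "A *\<^sub>v X = A *\<^sub>v (K *\<^sub>v (transpose_mat A *\<^sub>v b))"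
    and least_squares_center_residual: "transpose_mat A *\<^sub>v (b - A *\<^sub>v X) = 0\<^sub>v n"
    and least_squares_center_range: "\<exists>q\<in>carrier_vec m. x - X = transpose_mat A *\<^sub>v q"
proof -
  let ?T = "transpose_mat A"
  let ?H = "pinv (A * ?T)"
  have T: "?T \<in> carrier_mat n m" using A by simp
  have K: "K \<in> carrier_mat n n" unfolding K_def by (rule pinv_gram_carrier[OF A])
  define g where "g = K *\<^sub>v (?T *\<^sub>v b)"
  have g: "g \<in> carrier_vec n" unfolding g_def using K by (rule mult_mat_vec_carrier_row)
  define h where "h = ?H *\<^sub>v (A *\<^sub>v x)"
  have "?H \<in> carrier_mat m m" using pinv_gram_carrier[OF T] by simp
  then have h: "h \<in> carrier_vec m" unfolding h_def by (rule mult_mat_vec_carrier_row)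
  have Th: "?T *\<^sub>v h \<in> carrier_vec n" using T by (rule mult_mat_vec_carrier_row)
  have ATh: "A *\<^sub>v (?T *\<^sub>v h) = A *\<^sub>v x"
    using pinv_gram_normal_equation[OF T x] by (simp add: h_def)
  have Ax: "A *\<^sub>v x \<in> carrier_vec m" and Ag: "A *\<^sub>v g \<in> carrier_vec m"
    using A by (auto intro: mult_mat_vec_carrier_row)
  have Xeq: "X = g + (x - ?T *\<^sub>v h)"
    unfolding X_def g_def h_def euclid_proj_mat_kernel[OF A x] ..
  show X: "X \<in> carrier_vec n" unfolding Xeq using g x Th by simp
  have "A *\<^sub>v X = A *\<^sub>v g + (A *\<^sub>v x - A *\<^sub>v (?T *\<^sub>v h))"
    unfolding Xeq using g x Th
    by (simp add: mult_add_distrib_mat_vec[OF A] mult_minus_distrib_mat_vec[OF A])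
  also have "\<dots> = A *\<^sub>v g" unfolding ATh using Ax Ag by simp
  finally have AX: "A *\<^sub>v X = A *\<^sub>v g" .
  then show "A *\<^sub>v X = A *\<^sub>v (K *\<^sub>v (?T *\<^sub>v b))" unfolding g_def .
  have Tb: "?T *\<^sub>v b \<in> carrier_vec n" using T by (rule mult_mat_vec_carrier_row)
  have "?T *\<^sub>v (b - A *\<^sub>v X) = ?T *\<^sub>v b - ?T *\<^sub>v (A *\<^sub>v g)"
    unfolding AX by (rule mult_minus_distrib_mat_vec[OF T b Ag])
  also have "?T *\<^sub>v (A *\<^sub>v g) = ?T *\<^sub>v b"
    unfolding g_def K_def by (rule pinv_gram_normal_equation[OF A b])
  also have "?T *\<^sub>v b - ?T *\<^sub>v b = 0\<^sub>v n" using Tb by simp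
  finally show "?T *\<^sub>v (b - A *\<^sub>v X) = 0\<^sub>v n" .
  obtain z where z: "z \<in> carrier_vec m" "g = ?T *\<^sub>v z"
    using pinv_gram_range[OF A Tb] unfolding g_def K_def by blast
  have "x - (g + (x - v)) = v - g" if "v \<in> carrier_vec n" for v
    using g x that by (intro eq_vecI) auto
  then have "x - X = ?T *\<^sub>v h - ?T *\<^sub>v z" unfolding Xeq z(2)[symmetric] using Th by blast
  also have "\<dots> = ?T *\<^sub>v (h - z)" using mult_minus_distrib_mat_vec[OF T h z(1)] ..
  finally show "\<exists>q\<in>carrier_vec m. x - X = ?T *\<^sub>v q"
    using h z(1) by (intro bexI[of _ "h - z"]) auto
qed

text \<open>Here \<open>u\<close> and \<open>t\<close> are the rotating part and \<open>r\<close> is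
  the multiple of the ray reached so far. \<open>A\<close> annihilates \<open>V\<close> and its
  transpose annihilates \<open>U\<close>, so the ray does not affect the gradients, while the
  residuals at the center add exactly one more \<open>V\<close> and \<open>U\<close>.\<close>

lemma pdhg_affine_step:
  fixes A :: "real mat"
  assumes A: "A \<in> carrier_mat m n"
    and carr: "b \<in> carrier_vec m" "c \<in> carrier_vec n" "X \<in> carrier_vec n" "Y \<in> carrier_vec m"
      "u \<in> carrier_vec n" "t \<in> carrier_vec m"
    and V: "V = - \<eta> \<cdot>\<^sub>v (c - transpose_mat A *\<^sub>v Y)" "A *\<^sub>v V = 0\<^sub>v m"
    and U: "U = \<eta> \<cdot>\<^sub>v (b - A *\<^sub>v X)" "transpose_mat A *\<^sub>v U = 0\<^sub>v n"
    and x: "x = X + (u + r \<cdot>\<^sub>v V)" and y: "y = Y + (t + r \<cdot>\<^sub>v U)"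
    and x': "x' = x - \<eta> \<cdot>\<^sub>v (c - transpose_mat A *\<^sub>v y)"
    and y': "y' = y + \<eta> \<cdot>\<^sub>v (b - A *\<^sub>v (2 \<cdot>\<^sub>v x' - x))"
  shows "x' = X + ((u + \<eta> \<cdot>\<^sub>v (transpose_mat A *\<^sub>v t)) + (r + 1) \<cdot>\<^sub>v V)"
    and "y' = Y + ((t + ((- \<eta>) \<cdot>\<^sub>v (A *\<^sub>v u) + (- 2 * \<eta>\<^sup>2) \<cdot>\<^sub>v (A *\<^sub>v (transpose_mat A *\<^sub>v t))))
      + (r + 1) \<cdot>\<^sub>v U)"
proof -
  let ?T = "transpose_mat A"
  have T: "?T \<in> carrier_mat n m" using A by simp
  have Vc: "V \<in> carrier_vec n" and Uc: "U \<in> carrier_vec m" unfolding V(1) U(1)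
    using A carr by auto
  define a where "a = ?T *\<^sub>v t"
  define d where "d = ?T *\<^sub>v Y"
  define p where "p = A *\<^sub>v u"
  define q where "q = A *\<^sub>v a"
  define e where "e = A *\<^sub>v X"
  have c': "a \<in> carrier_vec n" "d \<in> carrier_vec n" "p \<in> carrier_vec m" "q \<in> carrier_vec m" "e \<in> carrier_vec m"
    unfolding a_def d_def p_def q_def e_def using A T by (auto intro!: mult_mat_vec_carrier_row)
  have smult_zero: "s \<cdot>\<^sub>v 0\<^sub>v k = 0\<^sub>v k" for s :: real and k by (intro eq_vecI) auto
  have "?T *\<^sub>v y = d + (a + r \<cdot>\<^sub>v 0\<^sub>v n)"
    unfolding y using carr Uc
    by (simp add: mult_add_distrib_mat_vec[OF T] mult_mat_vec[OF T] U(2) a_def d_def)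
  then have Ty: "?T *\<^sub>v y = d + a" using c' by (simp add: smult_zero)
  have xn: "x' = X + ((u + \<eta> \<cdot>\<^sub>v a) + (r + 1) \<cdot>\<^sub>v V)"
    unfolding x' Ty x V(1) d_def[symmetric] using carr c' Vc
    by (intro eq_vecI) (auto simp: algebra_simps)
  then show "x' = X + ((u + \<eta> \<cdot>\<^sub>v (?T *\<^sub>v t)) + (r + 1) \<cdot>\<^sub>v V)" unfolding a_def .
  \<comment> \<open>Extrapolation leaves \<open>2 * (r + 1) - r = r + 2\<close> copies of
    \<open>V\<close>, which \<open>A\<close> then annihilates.\<close>
  have "2 \<cdot>\<^sub>v x' - x = X + (u + ((2 * \<eta>) \<cdot>\<^sub>v a + (r + 2) \<cdot>\<^sub>v V))"
    unfolding xn x using carr c' Vc by (intro eq_vecI) (auto simp: algebra_simps)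
  moreover have "A *\<^sub>v \<dots> = e + (p + ((2 * \<eta>) \<cdot>\<^sub>v q + (r + 2) \<cdot>\<^sub>v 0\<^sub>v m))"
    using carr c' Vc
    by (simp add: mult_add_distrib_mat_vec[OF A] mult_mat_vec[OF A] V(2) p_def q_def e_def)
  ultimately have Ax: "A *\<^sub>v (2 \<cdot>\<^sub>v x' - x) = e + (p + (2 * \<eta>) \<cdot>\<^sub>v q)" using c' by (simp add: smult_zero)
  show "y' = Y + ((t + ((- \<eta>) \<cdot>\<^sub>v (A *\<^sub>v u) + (- 2 * \<eta>\<^sup>2) \<cdot>\<^sub>v (A *\<^sub>v (?T *\<^sub>v t)))) + (r + 1) \<cdot>\<^sub>v U)"
    unfolding y' Ax y U(1) a_def[symmetric] p_def[symmetric] q_def[symmetric] e_def[symmetric]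
    using carr c' by (intro eq_vecI) (auto simp: algebra_simps power2_eq_square)
qed

section \<open>Selecting coordinates\<close>

lemma pick_bij_betw:
  assumes "finite B"
  shows "bij_betw (pick B) {..<card B} B"
proof -
  have inj: "inj_on (pick B) {..<card B}"
    by (intro linorder_inj_onI) (auto dest: pick_mono_le)
  moreover have "pick B ` {..<card B} \<subseteq> B" using pick_in_set_le by auto
  ultimately show ?thesis
    using assms by (simp add: bij_betw_def card_image card_subset_eq)
qed

lemma card_less_dim: "B \<subseteq> {..<n} \<Longrightarrow> card {i. i < n \<and> i \<in> B} = card (B :: nat set)"
  by (rule arg_cong[of _ _ card]) auto

lemma subvec_carrier: "x \<in> carrier_vec n \<Longrightarrow> B \<subseteq> {..<n} \<Longrightarrow> subvec x B \<in> carrier_vec (card B)"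
  by (simp add: subvec_def card_less_dim)

lemma subvec_index:
  "x \<in> carrier_vec n \<Longrightarrow> B \<subseteq> {..<n} \<Longrightarrow> j < card B \<Longrightarrow> subvec x B $ j = x $ pick B j"
  by (simp add: subvec_def card_less_dim)

lemma pick_less: "B \<subseteq> {..<n} \<Longrightarrow> j < card B \<Longrightarrow> pick B j < n"
  using pick_in_set_le by auto

lemma subcols_carrier: "A \<in> carrier_mat m n \<Longrightarrow> B \<subseteq> {..<n} \<Longrightarrow> subcols A B \<in> carrier_mat m (card B)"
  by (auto simp: subcols_def dim_submatrix card_less_dim)

lemma subcols_index:
  assumes "A \<in> carrier_mat m n" "B \<subseteq> {..<n}" "i < m" "j < card B"
  shows "subcols A B $$ (i, j) = A $$ (i, pick B j)"
  using assms unfolding subcols_def by (subst submatrix_index) (auto simp: card_less_dim pick_UNIV)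

lemma subvec_minus:
  assumes "x \<in> carrier_vec n" "y \<in> carrier_vec n" "B \<subseteq> {..<n}"
  shows "subvec (x - y) B = subvec x B - subvec y B"
  using assms by (intro eq_vecI)
    (auto simp: subvec_index[of _ n] pick_less carrier_vecD[OF subvec_carrier[of _ n]])

lemma subvec_smult:
  assumes "x \<in> carrier_vec n" "B \<subseteq> {..<n}"
  shows "subvec (a \<cdot>\<^sub>v x) B = a \<cdot>\<^sub>v subvec x B"
  using assms by (intro eq_vecI)
    (auto simp: subvec_index[of _ n] pick_less carrier_vecD[OF subvec_carrier[of _ n]])

lemma subvec_scalar_prod:
  assumes v: "v \<in> carrier_vec n" and x: "x \<in> carrier_vec n" and B: "B \<subseteq> {..<n}"
    and supp: "\<And>i. i < n \<Longrightarrow> i \<notin> B \<Longrightarrow> x $ i = 0"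
  shows "v \<bullet> x = subvec v B \<bullet> subvec x B"
proof -
  have "v \<bullet> x = (\<Sum>i<n. v $ i * x $ i)" using x by (simp add: scalar_prod_def atLeast0LessThan)
  also have "\<dots> = (\<Sum>i\<in>B. v $ i * x $ i)" using B supp by (intro sum.mono_neutral_right) auto
  also have "\<dots> = (\<Sum>j<card B. v $ pick B j * x $ pick B j)"
    using sum.reindex_bij_betw[OF pick_bij_betw[OF finite_subset[OF B finite_lessThan]],
        of "\<lambda>i. v $ i * x $ i"] ..
  also have "\<dots> = subvec v B \<bullet> subvec x B"
    using v x B by (simp add: scalar_prod_def atLeast0LessThan subvec_index[of _ n]
        carrier_vecD[OF subvec_carrier[of _ n]])
  finally show ?thesis .
qed

lemma row_subcols:
  assumes "A \<in> carrier_mat m n" "B \<subseteq> {..<n}" "i < m"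
  shows "row (subcols A B) i = subvec (row A i) B"
proof (rule eq_vecI)
  have r: "row A i \<in> carrier_vec n" using assms by auto
  show "dim_vec (row (subcols A B) i) = dim_vec (subvec (row A i) B)"
    using carrier_vecD[OF subvec_carrier[OF r assms(2)]] carrier_matD[OF subcols_carrier[OF assms(1,2)]] by simp
  fix j assume "j < dim_vec (subvec (row A i) B)"
  then have j: "j < card B" using carrier_vecD[OF subvec_carrier[OF r assms(2)]] by simp
  then show "row (subcols A B) i $ j = subvec (row A i) B $ j"
    using assms carrier_matD[OF subcols_carrier[OF assms(1,2)]] pick_less[OF assms(2) j]
    by (simp add: subvec_index[OF r assms(2) j] subcols_index)
qed

lemma subcols_mult_subvec:
  assumes A: "A \<in> carrier_mat m n" and x: "x \<in> carrier_vec n" and B: "B \<subseteq> {..<n}"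
    and supp: "\<And>i. i < n \<Longrightarrow> i \<notin> B \<Longrightarrow> x $ i = 0"
  shows "subcols A B *\<^sub>v subvec x B = A *\<^sub>v x"
proof (rule eq_vecI)
  fix i assume "i < dim_vec (A *\<^sub>v x)"
  then have i: "i < m" using A by simp
  then have "row A i \<in> carrier_vec n" using A by auto
  from subvec_scalar_prod[OF this x B supp] show "(subcols A B *\<^sub>v subvec x B) $ i = (A *\<^sub>v x) $ i"
    using i A carrier_matD[OF subcols_carrier[OF A B]] by (simp add: row_subcols[OF A B i])
qed (use A carrier_matD[OF subcols_carrier[OF A B]] in simp)

lemma subvec_transpose_mult:
  assumes A: "A \<in> carrier_mat m n" and B: "B \<subseteq> {..<n}"
  shows "subvec (transpose_mat A *\<^sub>v y) B = transpose_mat (subcols A B) *\<^sub>v y"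
proof (rule eq_vecI)
  have Ty: "transpose_mat A *\<^sub>v y \<in> carrier_vec n" using A by (intro carrier_vecI) simp
  note S = carrier_matD[OF subcols_carrier[OF A B]]
  show "dim_vec (subvec (transpose_mat A *\<^sub>v y) B) = dim_vec (transpose_mat (subcols A B) *\<^sub>v y)"
    using carrier_vecD[OF subvec_carrier[OF Ty B]] S by simp
  fix j assume "j < dim_vec (transpose_mat (subcols A B) *\<^sub>v y)"
  then have j: "j < card B" using S by simp
  have "col (subcols A B) j = col A (pick B j)"
    using A S j pick_less[OF B j] by (intro eq_vecI) (auto simp: subcols_index[OF A B])
  then show "subvec (transpose_mat A *\<^sub>v y) B $ j = (transpose_mat (subcols A B) *\<^sub>v y) $ j"
    using A S j pick_less[OF B j] by (simp add: subvec_index[OF Ty B j])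
qed

text \<open>Extending \<open>u\<close> by zero outside \<open>B\<close> changes neither its norm nor
  its image, so the bound for the full matrix applies.\<close>

lemma vnorm_subcols_mult_le:
  assumes A: "A \<in> carrier_mat m n" and B: "B \<subseteq> {..<n}" and u: "u \<in> carrier_vec (card B)"
  shows "vnorm (subcols A B *\<^sub>v u) \<le> spectral_norm A * vnorm u"
proof -
  \<comment> \<open>\<open>f\<close> gives the position of an index in the increasing enumeration of
    \<open>B\<close>.\<close>
  define f where "f = inv_into {..<card B} (pick B)"
  define x where "x = vec n (\<lambda>i. if i \<in> B then u $ f i else 0)"
  have bij: "bij_betw (pick B) {..<card B} B" by (rule pick_bij_betw[OF finite_subset[OF B finite_lessThan]])
  have x: "x \<in> carrier_vec n" by (simp add: x_def)
  have supp: "x $ i = 0" if "i < n" "i \<notin> B" for i using that by (simp add: x_def)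
  have ux: "subvec x B = u"
  proof (rule eq_vecI)
    fix j assume "j < dim_vec u"
    then have j: "j < card B" using u by simp
    then have "f (pick B j) = j" unfolding f_def using bij by (simp add: bij_betw_inv_into_left)
    then show "subvec x B $ j = u $ j"
      using pick_less[OF B j] pick_in_set_le[OF j] by (subst subvec_index[OF x B j]) (simp add: x_def)
  qed (use u carrier_vecD[OF subvec_carrier[OF x B]] in simp)
  have "vnorm x = vnorm u" unfolding vnorm_def using subvec_scalar_prod[OF x x B supp] ux by simp
  moreover have "subcols A B *\<^sub>v u = A *\<^sub>v x"
    using subcols_mult_subvec[OF A x B supp] unfolding ux .
  ultimately show ?thesis using spectral_norm_bound[OF A x] by simp
qed

section \<open>The phase\<close>

lemma pdhg_carrier:
  assumes A: "A \<in> carrier_mat m n"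
    and z: "z \<in> nonneg_orthant n \<times> carrier_vec m"
  shows "pdhg A b c \<eta> z k \<in> nonneg_orthant n \<times> carrier_vec m"
proof (induction k)
  case (Suc k)
  obtain x y where xy: "pdhg A b c \<eta> z k = (x, y)" by force
  then have y: "y \<in> carrier_vec m"
    using Suc.IH by (auto simp: nonneg_orthant_def)
  have "primal_gradient_step A c \<eta> (x, y) \<in> carrier_vec n"
    using A by (intro carrier_vecI) (simp add: primal_gradient_step_def)
  note proj = euclid_proj_nonneg_orthant[OF this]
  have "y + \<eta> \<cdot>\<^sub>v (b - A *\<^sub>v v) \<in> carrier_vec m" for v
    using A y by (intro carrier_vecI) simp
  then have "pdhg_step A b c \<eta> (x, y) \<in> nonneg_orthant n \<times> carrier_vec m"
    unfolding pdhg_step_def Let_def using carrier_matD(2)[OF A] proj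
    by (simp add: nonneg_orthant_def)
  then show ?case unfolding xy[symmetric] by (simp add: pdhg_def)
qed (use z in \<open>simp add: pdhg_def\<close>)

text \<open>A negative coordinate would belong to neither set, so it is membership in the orthant
  that makes every coordinate outside \<open>B\<close> vanish.\<close>

lemma pdhg_basis_partition:
  assumes A: "A \<in> carrier_mat m n" and x: "x \<in> nonneg_orthant n"
    and BN: "pdhg_basis A c (x, y) = (B, N)"
  shows "B \<subseteq> {..<n}" "N \<subseteq> {..<n}" "\<And>i. i \<in> N \<Longrightarrow> x $ i = 0"
    "\<And>i. i < n \<Longrightarrow> i \<notin> B \<Longrightarrow> x $ i = 0"
proof -
  have "0 \<le> x $ i" if "i < n" for i using x that by (auto simp: nonneg_orthant_def)
  then show "B \<subseteq> {..<n}" "N \<subseteq> {..<n}" "\<And>i. i \<in> N \<Longrightarrow> x $ i = 0"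
    "\<And>i. i < n \<Longrightarrow> i \<notin> B \<Longrightarrow> x $ i = 0"
    using A BN by (fastforce simp: pdhg_basis_def)+
qed

text \<open>The formula for step \<open>k\<close> carries the condition that no earlier step of the
  phase clipped a coordinate in \<open>B\<close>; the example at \<open>unclipped_on\<close> shows
  that a shared basis does not imply this. The limit and the orthogonality concern the powers of
  \<open>P\<close> alone and hold for phases of any length. The product form of the step size bound
  also covers \<open>A = 0\<close>.\<close>

theorem theorem7:
  fixes A :: "real mat" and b c :: "real vec" and \<eta> :: real and m n :: nat
    and x_init y_init :: "real vec" and s :: nat and L :: enat and B N :: "nat set"
    and x y :: "nat \<Rightarrow> real vec"
    and AB P :: "real mat" and xv yv vx vy w :: "real vec"
  assumes A: "A \<in> carrier_mat m n" and b: "b \<in> carrier_vec m" and c: "c \<in> carrier_vec n"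
    and \<eta>: "0 < \<eta>" "\<eta> * spectral_norm A < 1"
    and init: "x_init \<in> nonneg_orthant n" "y_init \<in> carrier_vec m"
    and phase: "pdhg_phase A b c \<eta> (x_init, y_init) s L B N"
    and iterates: "\<And>k. (x k, y k) = pdhg A b c \<eta> (x_init, y_init) (s + k)"
    and AB: "AB = subcols A B"
    and P: "P = P_mat AB \<eta>"
    and xv: "xv \<in> carrier_vec n"
      "subvec xv B = pinv (transpose_mat AB * AB) *\<^sub>v (transpose_mat AB *\<^sub>v b)
                     + euclid_proj (mat_kernel AB) (subvec (x 0) B)"
      "subvec xv N = 0\<^sub>v (card N)"
    and yv: "yv = pinv (AB * transpose_mat AB) *\<^sub>v (AB *\<^sub>v subvec c B)
                  + euclid_proj (mat_kernel (transpose_mat AB)) (y 0)"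
    and vx: "vx \<in> carrier_vec n"
      "subvec vx B = - \<eta> \<cdot>\<^sub>v (subvec c B - transpose_mat AB *\<^sub>v
                       (pinv (AB * transpose_mat AB) *\<^sub>v (AB *\<^sub>v subvec c B)))"
      "subvec vx N = 0\<^sub>v (card N)"
    and vy: "vy = \<eta> \<cdot>\<^sub>v (b - AB *\<^sub>v (pinv (transpose_mat AB * AB) *\<^sub>v (transpose_mat AB *\<^sub>v b)))"
    and w: "w = (subvec (x 0) B - subvec xv B) @\<^sub>v (y 0 - yv)"
  shows "(\<forall>k. enat k < L \<longrightarrow> (\<forall>j<k. unclipped_on A c \<eta> B (x j, y j)) \<longrightarrow>
            (subvec (x k) B - subvec xv B) @\<^sub>v (y k - yv)
              = P ^\<^sub>m k *\<^sub>v w + real k \<cdot>\<^sub>v (subvec vx B @\<^sub>v vy)) \<and>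
         (\<forall>k. enat k < L \<longrightarrow> subvec (x k) N = 0\<^sub>v (card N)) \<and>
         vec_tendsto (\<lambda>k. P ^\<^sub>m k *\<^sub>v w) (0\<^sub>v (card B + m)) \<and>
         (\<forall>k. (subvec vx B @\<^sub>v vy) \<bullet> (P ^\<^sub>m k *\<^sub>v w) = 0)"
proof -
  let ?T = "transpose_mat AB"
  let ?cB = "subvec c B"
  define X where "X = subvec xv B"
  define V where "V = subvec vx B"
  have state: "(x k, y k) \<in> nonneg_orthant n \<times> carrier_vec m" for k
    unfolding iterates using init by (intro pdhg_carrier A) auto
  then have xo: "x k \<in> nonneg_orthant n" and xc: "x k \<in> carrier_vec n" and yc: "y k \<in> carrier_vec m" for k
    by (auto simp: nonneg_orthant_def)
  have basis: "pdhg_basis A c (x k, y k) = (B, N)" if "enat k < L" for k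
    using phase that unfolding pdhg_phase_def iterates by blast
  have L0: "enat 0 < L" using phase by (simp add: pdhg_phase_def zero_enat_def)
  note part = pdhg_basis_partition[OF A xo basis]
  have B: "B \<subseteq> {..<n}" and N: "N \<subseteq> {..<n}" using part(1,2)[OF L0] by auto
  have ABc: "AB \<in> carrier_mat m (card B)" unfolding AB by (rule subcols_carrier[OF A B])
  have Tc: "?T \<in> carrier_mat (card B) m" using ABc by simp
  have cB: "?cB \<in> carrier_vec (card B)" by (rule subvec_carrier[OF c B])
  have xB: "subvec (x k) B \<in> carrier_vec (card B)" for k by (rule subvec_carrier[OF xc B])

  note cx = least_squares_center[OF ABc b xB[of 0], folded xv(2) X_def]
  \<comment> \<open>The dual half: the same least squares problem for the transpose of
    \<open>AB\<close>, with data \<open>subvec c B\<close> and starting point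
    \<open>y 0\<close>.\<close>
  note cy = least_squares_center[OF Tc cB yc[of 0], unfolded transpose_transpose, folded yv]
  have Vc: "V \<in> carrier_vec (card B)" unfolding V_def by (rule subvec_carrier[OF vx(1) B])
  have Xc: "X \<in> carrier_vec (card B)" by (rule cx(1))
  have Yc: "yv \<in> carrier_vec m" by (rule cy(1))
  have AX: "AB *\<^sub>v X \<in> carrier_vec m" and TY: "?T *\<^sub>v yv \<in> carrier_vec (card B)"
    using ABc Tc by (auto intro: mult_mat_vec_carrier_row)
  have V: "V = - \<eta> \<cdot>\<^sub>v (?cB - ?T *\<^sub>v yv)" unfolding V_def vx(2) cy(2) ..
  have U: "vy = \<eta> \<cdot>\<^sub>v (b - AB *\<^sub>v X)" unfolding vy cx(2) ..
  have Uc: "vy \<in> carrier_vec m" unfolding U using b AX by simp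
  have smult_zero: "s \<cdot>\<^sub>v 0\<^sub>v k = 0\<^sub>v k" for s :: real and k by (intro eq_vecI) auto
  have AV: "AB *\<^sub>v V = 0\<^sub>v m"
    unfolding V using cB TY cy(3) by (simp add: mult_mat_vec[OF ABc] smult_zero)
  have TU: "?T *\<^sub>v vy = 0\<^sub>v (card B)"
    unfolding U using b AX cx(3) by (simp add: mult_mat_vec[OF Tc] smult_zero)

  obtain q where q: "q \<in> carrier_vec m" "subvec (x 0) B - X = ?T *\<^sub>v q" using cx(4) by blast
  obtain r where r: "r \<in> carrier_vec (card B)" "y 0 - yv = AB *\<^sub>v r" using cy(4) by blast
  have w': "w = (?T *\<^sub>v q) @\<^sub>v (AB *\<^sub>v r)" unfolding w X_def[symmetric] q(2) r(2) ..
  obtain u t where Pk: "\<And>k. P ^\<^sub>m k *\<^sub>v w = u k @\<^sub>v t k"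
    and ur: "\<And>k. \<exists>q\<in>carrier_vec m. u k = ?T *\<^sub>v q"
    and tr: "\<And>k. \<exists>r\<in>carrier_vec (card B). t k = AB *\<^sub>v r"
    and us: "\<And>k. u (Suc k) = u k + \<eta> \<cdot>\<^sub>v (?T *\<^sub>v t k)"
    and ts: "\<And>k. t (Suc k) = t k + ((- \<eta>) \<cdot>\<^sub>v (AB *\<^sub>v u k)
      + (- 2 * \<eta>\<^sup>2) \<cdot>\<^sub>v (AB *\<^sub>v (?T *\<^sub>v t k)))"
    using P_mat_power_on_range[OF ABc q(1) r(1), of \<eta>, folded P w'] by blast
  have uc: "u k \<in> carrier_vec (card B)" and tc: "t k \<in> carrier_vec m" for k
    using ur[of k] tr[of k] ABc Tc by (auto intro!: mult_mat_vec_carrier_row)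
  have Pc: "P \<in> carrier_mat (card B + m) (card B + m)" unfolding P by (rule P_mat_carrier[OF ABc])
  have "w \<in> carrier_vec (card B + m)" unfolding w' using Tc ABc by (intro append_carrier_vec mult_mat_vec_carrier_row)
  \<comment> \<open>The zeroth power is the identity, so comparing blocks recovers the initial
    deviation.\<close>
  then have "u 0 @\<^sub>v t 0 = (subvec (x 0) B - X) @\<^sub>v (y 0 - yv)"
    using Pk[of 0] Pc unfolding w X_def by simp
  then have u0: "u 0 = subvec (x 0) B - X" and t0: "t 0 = y 0 - yv"
    using append_vec_eq[OF uc[of 0], of "subvec (x 0) B - X"] xB[of 0] Xc by auto

  \<comment> \<open>\<open>u k\<close> and \<open>t k\<close> exist for all \<open>k\<close> as
    blocks of powers of \<open>P\<close>. The iterates follow them, shifted by \<open>k\<close>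
    copies of the ray, while the phase lasts and nothing in \<open>B\<close> is clipped.\<close>
  have main: "subvec (x k) B = X + (u k + real k \<cdot>\<^sub>v V) \<and> y k = yv + (t k + real k \<cdot>\<^sub>v vy)"
    if "enat k < L" "\<forall>j<k. unclipped_on A c \<eta> B (x j, y j)" for k
    using that
  proof (induction k)
    case 0
    show ?case unfolding u0 t0 using xB[of 0] Xc Yc yc[of 0] Vc Uc by (auto intro!: eq_vecI)
  next
    case (Suc k)
    have kL: "enat k < L" using Suc.prems(1) by (meson enat_ord_simps(2) lessI less_trans)
    have IH: "subvec (x k) B = X + (u k + real k \<cdot>\<^sub>v V)" "y k = yv + (t k + real k \<cdot>\<^sub>v vy)"
      using Suc.IH[OF kL] Suc.prems(2) by auto
    have unc: "unclipped_on A c \<eta> B (x k, y k)" using Suc.prems(2) by simp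
    define g where "g = primal_gradient_step A c \<eta> (x k, y k)"
    have ATy: "transpose_mat A *\<^sub>v y k \<in> carrier_vec n" using A by (intro mult_mat_vec_carrier_row) simp
    have geq: "g = x k - \<eta> \<cdot>\<^sub>v (c - transpose_mat A *\<^sub>v y k)" by (simp add: g_def primal_gradient_step_def)
    have gc: "g \<in> carrier_vec n" unfolding geq using xc c ATy by simp
    have "(x (Suc k), y (Suc k)) = pdhg_step A b c \<eta> (x k, y k)"
      unfolding iterates by (simp add: pdhg_def)
    then have xs: "x (Suc k) = vec n (\<lambda>i. max 0 (g $ i))"
      and ys: "y (Suc k) = y k + \<eta> \<cdot>\<^sub>v (b - A *\<^sub>v (2 \<cdot>\<^sub>v x (Suc k) - x k))"
      using A euclid_proj_nonneg_orthant[OF gc] by (auto simp: pdhg_step_def Let_def g_def)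
    \<comment> \<open>On \<open>B\<close> the maximum with zero is inactive because the step is
      unclipped there.\<close>
    have "subvec (x (Suc k)) B = subvec g B"
    proof (rule eq_vecI)
      fix j assume "j < dim_vec (subvec g B)"
      then have j: "j < card B" using carrier_vecD[OF subvec_carrier[OF gc B]] by simp
      have "0 \<le> g $ pick B j" using unc pick_in_set_le[OF j] by (simp add: unclipped_on_def g_def)
      then show "subvec (x (Suc k)) B $ j = subvec g B $ j"
        using pick_less[OF B j] by (simp add: subvec_index[OF xc B j] subvec_index[OF gc B j])
          (simp add: xs)
    qed (use carrier_vecD[OF xB] carrier_vecD[OF subvec_carrier[OF gc B]] in simp)
    also have "\<dots> = subvec (x k) B - \<eta> \<cdot>\<^sub>v (?cB - ?T *\<^sub>v y k)"
      unfolding geq AB subvec_transpose_mult[OF A B, symmetric]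
      using xc c ATy by (simp add: subvec_minus[OF _ _ B] subvec_smult[OF _ B])
    finally have xs': "subvec (x (Suc k)) B = subvec (x k) B - \<eta> \<cdot>\<^sub>v (?cB - ?T *\<^sub>v y k)" .
    have dc: "2 \<cdot>\<^sub>v x (Suc k) - x k \<in> carrier_vec n" using xc by simp
    \<comment> \<open>Both iterates belong to the phase and vanish outside \<open>B\<close>, so
      \<open>A\<close> acts on the extrapolated point through its columns in \<open>B\<close> only.
      For \<open>x (Suc k)\<close> this needs step \<open>Suc k\<close> to be still within the
      phase.\<close>
    have "A *\<^sub>v (2 \<cdot>\<^sub>v x (Suc k) - x k) = AB *\<^sub>v subvec (2 \<cdot>\<^sub>v x (Suc k) - x k) B"
      unfolding AB
    proof (rule subcols_mult_subvec[OF A dc B, symmetric])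
      fix i assume "i < n" "i \<notin> B"
      then show "(2 \<cdot>\<^sub>v x (Suc k) - x k) $ i = 0"
        using part(4)[OF kL] part(4)[OF Suc.prems(1)] carrier_vecD[OF xc] by simp
    qed
    also have "subvec (2 \<cdot>\<^sub>v x (Suc k) - x k) B = 2 \<cdot>\<^sub>v subvec (x (Suc k)) B - subvec (x k) B"
      using xc by (simp add: subvec_minus[OF _ _ B] subvec_smult[OF _ B])
    finally have ys': "y (Suc k) = y k + \<eta> \<cdot>\<^sub>v (b - AB *\<^sub>v (2 \<cdot>\<^sub>v subvec (x (Suc k)) B - subvec (x k) B))"
      unfolding ys by simp
    have Sk: "real (Suc k) = real k + 1" by simp
    show ?case unfolding Sk us ts
      using pdhg_affine_step[OF ABc b cB Xc Yc uc tc V AV U TU IH xs' ys'] by blast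
  qed

  have "(subvec (x k) B - subvec xv B) @\<^sub>v (y k - yv)
      = P ^\<^sub>m k *\<^sub>v w + real k \<cdot>\<^sub>v (subvec vx B @\<^sub>v vy)"
    if "enat k < L" "\<forall>j<k. unclipped_on A c \<eta> B (x j, y j)" for k
  proof -
    note eq = main[OF that, THEN conjunct1] main[OF that, THEN conjunct2]
    have "subvec (x k) B - X = u k + real k \<cdot>\<^sub>v V" unfolding eq(1) using Xc uc Vc by (intro eq_vecI) auto
    moreover have "y k - yv = t k + real k \<cdot>\<^sub>v vy" unfolding eq(2) using Yc tc Uc by (intro eq_vecI) auto
    moreover have "real k \<cdot>\<^sub>v (V @\<^sub>v vy) = (real k \<cdot>\<^sub>v V) @\<^sub>v (real k \<cdot>\<^sub>v vy)"
      by (intro eq_vecI) auto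
    moreover have "(u k @\<^sub>v t k) + ((real k \<cdot>\<^sub>v V) @\<^sub>v (real k \<cdot>\<^sub>v vy))
        = (u k + real k \<cdot>\<^sub>v V) @\<^sub>v (t k + real k \<cdot>\<^sub>v vy)"
      using uc tc Vc Uc by (intro append_vec_add) auto
    ultimately show ?thesis unfolding Pk X_def[symmetric] V_def[symmetric] by simp
  qed
  moreover have "subvec (x k) N = 0\<^sub>v (card N)" if k: "enat k < L" for k
  proof (rule eq_vecI)
    fix j assume "j < dim_vec (0\<^sub>v (card N) :: real vec)"
    then have j: "j < card N" by simp
    show "subvec (x k) N $ j = 0\<^sub>v (card N) $ j"
      unfolding subvec_index[OF xc N j] using part(3)[OF k pick_in_set_le[OF j]] j by simp
  qed (use carrier_vecD[OF subvec_carrier[OF xc N]] in simp)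
  moreover have "vec_tendsto (\<lambda>k. P ^\<^sub>m k *\<^sub>v w) (0\<^sub>v (card B + m))"
  proof -
    have "(\<lambda>k. u k \<bullet> u k + t k \<bullet> t k) \<longlonglongrightarrow> 0"
      by (rule pdhg_energy_decay[where A = AB and \<eta> = \<eta> and \<sigma> = "spectral_norm A"])
        (rule ABc \<eta> spectral_norm_nonneg[OF A] vnorm_subcols_mult_le[OF A B, folded AB] ur tr us ts
          | assumption)+
    from tendsto_real_sqrt[OF this]
    have "(\<lambda>k. sqrt (u k \<bullet> u k + t k \<bullet> t k)) \<longlonglongrightarrow> 0" by simp
    moreover have "vnorm (P ^\<^sub>m k *\<^sub>v w - 0\<^sub>v (card B + m)) = sqrt (u k \<bullet> u k + t k \<bullet> t k)" for k
    proof -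
      have "(u k @\<^sub>v t k) - 0\<^sub>v (card B + m) = u k @\<^sub>v t k" using uc[of k] tc[of k] by (intro eq_vecI) auto
      then show ?thesis unfolding vnorm_def Pk using scalar_prod_append[OF uc tc uc tc] by simp
    qed
    moreover have "dim_vec (P ^\<^sub>m k *\<^sub>v w) = card B + m" for k using Pc by simp
    ultimately show ?thesis unfolding vec_tendsto_def by simp
  qed
  moreover have "(subvec vx B @\<^sub>v vy) \<bullet> (P ^\<^sub>m k *\<^sub>v w) = 0" for k
  proof -
    obtain q' r' where q': "q' \<in> carrier_vec m" "u k = ?T *\<^sub>v q'"
      and r': "r' \<in> carrier_vec (card B)" "t k = AB *\<^sub>v r'" using ur tr by blast
    \<comment> \<open>The kernel of \<open>AB\<close> is orthogonal to the range of
      \<open>?T\<close>, and the kernel of \<open>?T\<close> to the range of \<open>AB\<close>; the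
      two blocks of the product vanish separately.\<close>
    have "V \<bullet> u k = u k \<bullet> V" using Vc uc by (rule comm_scalar_prod)
    also have "\<dots> = 0" unfolding q'(2) transpose_vec_mult_scalar[OF ABc Vc q'(1)] AV using q' by simp
    finally have 1: "V \<bullet> u k = 0" .
    have "vy \<bullet> t k = (?T *\<^sub>v vy) \<bullet> r'"
      unfolding r'(2) by (rule transpose_vec_mult_scalar[OF ABc r'(1) Uc, symmetric])
    also have "\<dots> = 0" unfolding TU using r' by simp
    finally show ?thesis unfolding Pk V_def[symmetric] using 1 scalar_prod_append[OF Vc Uc uc tc] by simp
  qed
  ultimately show ?thesis by blast
qed

end
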